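(* Let $\lambda>0$ and let $V:\mathbb{R}^d\to\mathbb{R}$ be twice continuously differentiable with $\partial_{x_ix_j}V(x)\ge0$ for all $x\in\mathbb{R}^d$ and all $i,j\in\{1,\dots,d\}$. Consider the generator $\mathcal{L}$ on $\mathbb{N}^d$ with moves $\gamma_i^\pm$ and rates $c(\eta,\gamma_i^+)=\exp(-\nabla_i^+V(\eta))$, $c(\eta,\gamma_i^-)=\lambda\eta_i$, and assume that $$\inf_{\eta\in\mathbb{N}^d,\,1\le i\le d}\ \lambda-\sum_{j\ne i}\big[\exp(-\nabla_j^+V(\eta))-\exp(-\nabla_j^+V(\gamma_i^+\eta))\big]\ge0 .$$ Then: (i) Properties (Irr) and (Rev) hold with $\mathbf m(\eta)=\frac1Z e^{-V(\eta)}\prod_{i=1}^d\frac{\lambda^{-\eta_i}}{\eta_i!}$, and with $$\kappa=\inf_{\eta\in\mathbb{N}^d,\,1\le i\le d}\ \lambda+\big[e^{-\nabla_i^+V(\eta)}-e^{-\nabla_i^+V(\gamma_i^+\eta)}\big]-\sum_{j\ne i}\big[e^{-\nabla_j^+V(\eta)}-e^{-\nabla_j^+V(\gamma_i^+\eta)}\big]$$ the following hold: for every admissible $\phi$ the convex Sobolev inequality holds with $\kappa_\phi=\kappa$ (in particular the modified logarithmic Sobolev inequality holds with $\kappa_1=\kappa$), and for every $\alpha\in(1,2]$ the Beckner inequality holds with $\kappa_\alpha=\alpha\kappa$. (ii) If $$\kappa_{\mathbf 0}:=\min_{1\le i\le d}\ \lambda-\sum_{j\ne i}\exp(-\nabla_j^+V(\mathbf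 0))\ge0,\qquad \mathbf 0=(0,\dots,0)\in\mathbb{N}^d,$$ then the conclusions of (i) hold with $\kappa$ replaced by $\kappa_{\mathbf 0}$.
   Context: Setting: $d\ge1$, $\mathbb{N}=\{0,1,2,\dots\}$, $\Omega=\mathbb{N}^d$ with canonical basis $(\mathbf e_i)_{i\le d}$. The set of moves is $G=\{\gamma_i^+,\gamma_i^-:1\le i\le d\}$, with $\gamma_i^+\eta=\eta+\mathbf e_i$ and $\gamma_i^-\eta=\eta-\mathbf e_i\mathbf 1_{\{\eta_i>0\}}$. For a function $F$ on $\mathbb{N}^d$, $\nabla_i^{\pm}F(\eta)=F(\gamma_i^{\pm}\eta)-F(\eta)$ (applied to $V$ restricted to $\mathbb N^d$). Given rates $c:\Omega\times G\to[0,\infty)$, $\mathcal{L}f(\eta)=\sum_{i=1}^d c(\eta,\gamma_i^+)\nabla_i^+f(\eta)+c(\eta,\gamma_i^-)\nabla_i^-f(\eta)$. (Irr): $\mathcal L$ is irreducible and admits an invariant probability measure $\mathbf m$ with $\sum_{\eta\in\Omega,\sigma\in G}c(\eta,\sigma)\mathbf m(\eta)<\infty$. (Rev): with the involution $(\gamma_i^{\pm})^{-1}:=\gamma_i^{\mp}$ of $G$ one has $\sigma^{-1}(\sigma\eta)=\eta$ whenever $\mathbf m(\eta)c(\eta,\sigma)>0$, and $\sum_{\eta,\sigma}F(\eta,\sigma)c(\eta,\sigma)\mathbf m(\eta)=\sum_{\eta,\sigma}F(\sigma\eta,\sigma^{-1})c(\eta,\sigma)\mathbf m(\eta)$ for all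 bounded $F:\Omega\times G\to\mathbb R$. Admissible functions: $\phi:[0,\infty)\to[0,\infty)$ is admissible if it is convex, twice differentiable on $(0,\infty)$, and $\Phi(a,b):=(\phi'(b)-\phi'(a))(b-a)$ is convex on $(0,\infty)^2$. For $f:\Omega\to(0,\infty)$ with $\sum_\eta f(\eta)\mathbf m(\eta)<\infty$, $\mathcal H^\phi(f|\mathbf m)=\sum_\eta\phi(f(\eta))\mathbf m(\eta)-\phi\big(\sum_\eta f(\eta)\mathbf m(\eta)\big)\in[0,\infty]$. The convex Sobolev inequality with constant $\kappa_\phi$ is: for all such $f$, $$\kappa_\phi\,\mathcal H^\phi(f|\mathbf m)\le\frac12\sum_{\eta\in\Omega,\sigma\in G}c(\eta,\sigma)\,\Phi(f(\eta),f(\sigma\eta))\,\mathbf m(\eta)$$ (with the convention $0\cdot\infty=0$). Let $\phi_1(a)=a\log a-a+1$ and $\phi_\alpha(a)=\frac{1}{\alpha-1}(a^\alpha-a)-a+1$ for $\alpha\in(1,2]$. The modified logarithmic Sobolev inequality with constant $\kappa_1$ is the convex Sobolev inequality for $\phi=\phi_1$; the Beckner inequality with constant $\kappa_\alpha$ is the one for $\phi=\phi_\alpha$. *)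

theory Defs
  imports "HOL-Analysis.Analysis"
begin


datatype 'd move = Up 'd | Down 'd

primrec act :: "'d::finite move \<Rightarrow> nat ^ 'd \<Rightarrow> nat ^ 'd" where
  "act (Up i) \<eta> = \<eta> + axis i 1"
| "act (Down i) \<eta> = \<eta> - (if \<eta> $ i > 0 then axis i 1 else 0)"

primrec inv_move :: "'d move \<Rightarrow> 'd move" where
  "inv_move (Up i) = Down i"
| "inv_move (Down i) = Up i"

definition nabla :: "'d::finite move \<Rightarrow> (nat ^ 'd \<Rightarrow> real) \<Rightarrow> nat ^ 'd \<Rightarrow> real" where
  "nabla \<sigma> F \<eta> = F (act \<sigma> \<eta>) - F \<eta>"

definition generator ::
    "(nat ^ 'd::finite \<Rightarrow> 'd move \<Rightarrow> real) \<Rightarrow> (nat ^ 'd \<Rightarrow> real) \<Rightarrow> nat ^ 'd \<Rightarrow> real" where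
  "generator c f \<eta> =
     (\<Sum>i\<in>UNIV. c \<eta> (Up i) * nabla (Up i) f \<eta> + c \<eta> (Down i) * nabla (Down i) f \<eta>)"

definition irreducible_rates :: "(nat ^ 'd::finite \<Rightarrow> 'd move \<Rightarrow> real) \<Rightarrow> bool" where
  "irreducible_rates c \<longleftrightarrow> {(\<eta>, act \<sigma> \<eta>) |\<eta> \<sigma>. c \<eta> \<sigma> > 0}\<^sup>* = UNIV"

text \<open>A probability measure on the countable space is given by its mass function.\<close>

definition prob_mass :: "('a \<Rightarrow> real) \<Rightarrow> bool" where
  "prob_mass m \<longleftrightarrow> (\<forall>\<eta>. m \<eta> \<ge> 0) \<and> (m has_sum 1) UNIV"

text \<open>Invariance is taken at the level of the generator: the mean of \<open>generator c f\<close> under \<open>m\<close>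
  vanishes for every bounded \<open>f\<close> (convergence of the series being part of the requirement).\<close>

definition invariant_mass ::
    "(nat ^ 'd::finite \<Rightarrow> 'd move \<Rightarrow> real) \<Rightarrow> (nat ^ 'd \<Rightarrow> real) \<Rightarrow> bool" where
  "invariant_mass c m \<longleftrightarrow>
     (\<forall>f. bounded (range f) \<longrightarrow> ((\<lambda>\<eta>. generator c f \<eta> * m \<eta>) has_sum 0) UNIV)"

definition Irr :: "(nat ^ 'd::finite \<Rightarrow> 'd move \<Rightarrow> real) \<Rightarrow> (nat ^ 'd \<Rightarrow> real) \<Rightarrow> bool" where
  "Irr c m \<longleftrightarrow>
     irreducible_rates c \<and> prob_mass m \<and> invariant_mass c m \<and>
     (\<lambda>(\<eta>, \<sigma>). c \<eta> \<sigma> * m \<eta>) summable_on UNIV"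

text \<open>Meant to be used together with \<open>Irr\<close>, whose summability clause makes both series
  below converge absolutely for bounded \<open>F\<close>.\<close>

definition Rev :: "(nat ^ 'd::finite \<Rightarrow> 'd move \<Rightarrow> real) \<Rightarrow> (nat ^ 'd \<Rightarrow> real) \<Rightarrow> bool" where
  "Rev c m \<longleftrightarrow>
     (\<forall>\<eta> \<sigma>. m \<eta> * c \<eta> \<sigma> > 0 \<longrightarrow> act (inv_move \<sigma>) (act \<sigma> \<eta>) = \<eta>) \<and>
     (\<forall>F :: nat ^ 'd \<Rightarrow> 'd move \<Rightarrow> real. bounded (range (\<lambda>(\<eta>, \<sigma>). F \<eta> \<sigma>)) \<longrightarrow>
        (\<Sum>\<^sub>\<infinity>(\<eta>, \<sigma>)\<in>UNIV. F \<eta> \<sigma> * c \<eta> \<sigma> * m \<eta>) =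
        (\<Sum>\<^sub>\<infinity>(\<eta>, \<sigma>)\<in>UNIV. F (act \<sigma> \<eta>) (inv_move \<sigma>) * c \<eta> \<sigma> * m \<eta>))"



definition Phi :: "(real \<Rightarrow> real) \<Rightarrow> real \<Rightarrow> real \<Rightarrow> real" where
  "Phi \<phi> a b = (deriv \<phi> b - deriv \<phi> a) * (b - a)"

text \<open>A function \<open>\<phi>\<close> on the half-line is a total function whose values on negative arguments are
  irrelevant.\<close>

definition admissible :: "(real \<Rightarrow> real) \<Rightarrow> bool" where
  "admissible \<phi> \<longleftrightarrow>
     (\<forall>a\<ge>0. \<phi> a \<ge> 0) \<and> convex_on {0..} \<phi> \<and>
     (\<forall>a>0. \<phi> differentiable (at a) \<and> deriv \<phi> differentiable (at a)) \<and>
     convex_on ({0<..} \<times> {0<..}) (\<lambda>(a, b). Phi \<phi> a b)"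

text \<open>The series with values in \<open>ereal\<close> below have nonnegative terms (for \<open>\<phi> \<ge> 0\<close> on the
  half-line, respectively convex \<open>\<phi>\<close> and nonnegative rates), hence always have a value, possibly
  infinite. Moreover \<open>0 * \<infinity> = 0\<close> in \<open>ereal\<close>.\<close>

definition phi_entropy ::
    "(real \<Rightarrow> real) \<Rightarrow> (nat ^ 'd::finite \<Rightarrow> real) \<Rightarrow> (nat ^ 'd \<Rightarrow> real) \<Rightarrow> ereal" where
  "phi_entropy \<phi> f m =
     (\<Sum>\<^sub>\<infinity>\<eta>. ereal (\<phi> (f \<eta>) * m \<eta>)) - ereal (\<phi> (\<Sum>\<^sub>\<infinity>\<eta>. f \<eta> * m \<eta>))"

definition convex_sobolev ::
    "(nat ^ 'd::finite \<Rightarrow> 'd move \<Rightarrow> real) \<Rightarrow> (nat ^ 'd \<Rightarrow> real) \<Rightarrow> (real \<Rightarrow> real) \<Rightarrow> ereal \<Rightarrow> bool"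
  where
  "convex_sobolev c m \<phi> K \<longleftrightarrow>
     (\<forall>f. (\<forall>\<eta>. f \<eta> > 0) \<and> (\<lambda>\<eta>. f \<eta> * m \<eta>) summable_on UNIV \<longrightarrow>
        K * phi_entropy \<phi> f m \<le>
        1 / 2 * (\<Sum>\<^sub>\<infinity>(\<eta>, \<sigma>)\<in>UNIV. ereal (c \<eta> \<sigma> * Phi \<phi> (f \<eta>) (f (act \<sigma> \<eta>)) * m \<eta>)))"

definition phi_log :: "real \<Rightarrow> real" where
  "phi_log a = a * ln a - a + 1"

definition phi_beckner :: "real \<Rightarrow> real \<Rightarrow> real" where
  "phi_beckner \<alpha> a = 1 / (\<alpha> - 1) * (a powr \<alpha> - a) - a + 1"

definition modified_log_sobolev ::
    "(nat ^ 'd::finite \<Rightarrow> 'd move \<Rightarrow> real) \<Rightarrow> (nat ^ 'd \<Rightarrow> real) \<Rightarrow> ereal \<Rightarrow> bool" where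
  "modified_log_sobolev c m K \<longleftrightarrow> convex_sobolev c m phi_log K"

definition beckner ::
    "(nat ^ 'd::finite \<Rightarrow> 'd move \<Rightarrow> real) \<Rightarrow> (nat ^ 'd \<Rightarrow> real) \<Rightarrow> real \<Rightarrow> ereal \<Rightarrow> bool" where
  "beckner c m \<alpha> K \<longleftrightarrow> convex_sobolev c m (phi_beckner \<alpha>) K"



definition partial :: "'d::finite \<Rightarrow> (real ^ 'd \<Rightarrow> real) \<Rightarrow> real ^ 'd \<Rightarrow> real" where
  "partial i F x = deriv (\<lambda>t. F (x + t *\<^sub>R axis i 1)) 0"

definition twice_cont_diff :: "(real ^ 'd::finite \<Rightarrow> real) \<Rightarrow> bool" where
  "twice_cont_diff V \<longleftrightarrow>
     (\<exists>(V' :: real ^ 'd \<Rightarrow> (real ^ 'd) \<Rightarrow>\<^sub>L real)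
       (V'' :: real ^ 'd \<Rightarrow> (real ^ 'd) \<Rightarrow>\<^sub>L ((real ^ 'd) \<Rightarrow>\<^sub>L real)).
        (\<forall>x. (V has_derivative blinfun_apply (V' x)) (at x)) \<and>
        (\<forall>x. (V' has_derivative blinfun_apply (V'' x)) (at x)) \<and>
        continuous_on UNIV V'')"

definition lattice_restrict :: "(real ^ 'd::finite \<Rightarrow> real) \<Rightarrow> nat ^ 'd \<Rightarrow> real" where
  "lattice_restrict V \<eta> = V (\<chi> i. real (\<eta> $ i))"

definition birth_rate :: "(real ^ 'd::finite \<Rightarrow> real) \<Rightarrow> 'd \<Rightarrow> nat ^ 'd \<Rightarrow> real" where
  "birth_rate V i \<eta> = exp (- nabla (Up i) (lattice_restrict V) \<eta>)"

fun rates :: "real \<Rightarrow> (real ^ 'd::finite \<Rightarrow> real) \<Rightarrow> nat ^ 'd \<Rightarrow> 'd move \<Rightarrow> real" where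
  "rates lam V \<eta> (Up i) = birth_rate V i \<eta>"
| "rates lam V \<eta> (Down i) = lam * real (\<eta> $ i)"

definition gibbs_weight :: "real \<Rightarrow> (real ^ 'd::finite \<Rightarrow> real) \<Rightarrow> nat ^ 'd \<Rightarrow> real" where
  "gibbs_weight lam V \<eta> =
     exp (- lattice_restrict V \<eta>) * (\<Prod>i\<in>UNIV. (1 / lam) ^ (\<eta> $ i) / fact (\<eta> $ i))"

text \<open>If the normalising series diverged, \<open>infsum\<close> would give \<open>0\<close> and the function below would
  vanish identically, so \<open>prob_mass (gibbs lam V)\<close> includes finiteness of the series.\<close>

definition gibbs :: "real \<Rightarrow> (real ^ 'd::finite \<Rightarrow> real) \<Rightarrow> nat ^ 'd \<Rightarrow> real" where
  "gibbs lam V \<eta> = 1 / (\<Sum>\<^sub>\<infinity>\<xi>. gibbs_weight lam V \<xi>) * gibbs_weight lam V \<eta>"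

text \<open>The infimum is taken in \<open>ereal\<close>, where it needs no boundedness proviso.\<close>

definition kappa :: "real \<Rightarrow> (real ^ 'd::finite \<Rightarrow> real) \<Rightarrow> ereal" where
  "kappa lam V =
     (INF (\<eta>, i)\<in>UNIV. ereal
        (lam + (birth_rate V i \<eta> - birth_rate V i (act (Up i) \<eta>))
             - (\<Sum>j\<in>UNIV - {i}. birth_rate V j \<eta> - birth_rate V j (act (Up i) \<eta>))))"

definition kappa0 :: "real \<Rightarrow> (real ^ 'd::finite \<Rightarrow> real) \<Rightarrow> real" where
  "kappa0 lam V = (MIN i. lam - (\<Sum>j\<in>UNIV - {i}. birth_rate V j 0))"

end

theory Submission imports Defs begin

text \<open>
  For a single pair of neighbours \<open>\<eta>\<close>, \<open>\<eta>' = \<eta> + e\<^sub>i\<close> run the dynamics coupled: common births at the rates at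
  \<open>\<eta>'\<close>, common deaths at the rates at \<open>\<eta>\<close>, the surplus births \<open>j \<noteq> i\<close> of \<open>\<eta>\<close> matched with the surplus
  death of \<open>\<eta>'\<close> (which turns the pair into \<open>(\<eta> + e\<^sub>j, \<eta>)\<close>), while all remaining surplus moves merge the
  two particles, at total rate at least \<open>\<kappa>\<close>. Summed against the reversible weights, the non-merging
  terms cancel, so by joint convexity of \<open>\<Phi>\<close> the energy
  \<open>\<Sum> m(\<eta>) c(\<eta>, \<gamma>\<^sub>i\<^sup>+) \<Phi>(f \<eta>, f (\<eta> + e\<^sub>i))\<close> decays at rate \<open>\<kappa>\<close> (at rate \<open>\<alpha> \<kappa>\<close> in the Beckner case, because there
  \<open>\<Phi>(a + t (b - a), b) \<le> (1 - t)\<^sup>\<alpha> \<Phi>(a, b)\<close>), and this energy bounds the entropy dissipation.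

  No semigroup on the infinite lattice is needed: killing the births that leave a box preserves every
  hypothesis, and on the finite box the semigroup is replaced by the iterates of the stochastic
  matrix \<open>1 + \<epsilon> L\<close>, for which convexity gives the decay and the dissipation bound without derivatives,
  up to an error of relative order \<open>\<epsilon>\<close>.
\<close>

section \<open>Convex costs on the quadrant\<close>

lemma segment_pos:
  fixes a b t :: real
  assumes "0 < a" "0 < b" "t \<in> {0..1}"
  shows "0 < a + t * (b - a)"
proof (cases "t = 1")
  case False
  then have "0 < (1 - t) * a" "0 \<le> t * b" using assms by auto
  then show ?thesis by (simp add: algebra_simps)
qed (use assms in simp)

text \<open>The leftover weight \<open>1 - sum w A\<close> sits at \<open>p0\<close>, so this is
  ordinary Jensen with one extra point. The increment form matches a Markov step, which is the
  identity plus small jumps.\<close>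

lemma convex_on_jensen_base:
  fixes F :: "'b::real_vector \<Rightarrow> real"
  assumes "convex_on S F" "finite A" "p0 \<in> S"
    and "\<And>k. k \<in> A \<Longrightarrow> p k \<in> S" "\<And>k. k \<in> A \<Longrightarrow> 0 \<le> w k" "sum w A \<le> 1"
  shows "F (p0 + (\<Sum>k\<in>A. w k *\<^sub>R (p k - p0))) \<le> F p0 + (\<Sum>k\<in>A. w k * (F (p k) - F p0))"
proof -
  define T where "T = insert None (Some ` A)"
  define a where "a = case_option (1 - sum w A) w"
  define q where "q = case_option p0 p"
  have split: "(\<Sum>k\<in>T. g k) = g None + (\<Sum>k\<in>A. g (Some k))"
    for g :: "'a option \<Rightarrow> 'c::ab_group_add"
    unfolding T_def using assms(2) by (simp add: image_iff sum.reindex)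
  have "F (\<Sum>k\<in>T. a k *\<^sub>R q k) \<le> (\<Sum>k\<in>T. a k * F (q k))"
  proof (rule convex_on_sum[OF _ _ assms(1)])
    show "finite T" "T \<noteq> {}" using assms(2) by (auto simp: T_def)
    show "sum a T = 1" by (simp only: split) (simp add: a_def)
    show "0 \<le> a k" if "k \<in> T" for k using that assms(5,6) by (auto simp: T_def a_def)
    show "q k \<in> S" if "k \<in> T" for k using that assms(3,4) by (auto simp: T_def q_def)
  qed
  moreover have "(\<Sum>k\<in>T. a k *\<^sub>R q k) = p0 + (\<Sum>k\<in>A. w k *\<^sub>R (p k - p0))"
    by (simp only: split)
      (simp add: a_def q_def scaleR_diff_right scaleR_diff_left sum_subtractf scaleR_sum_left)
  moreover have "(\<Sum>k\<in>T. a k * F (q k)) = F p0 + (\<Sum>k\<in>A. w k * (F (p k) - F p0))"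
    by (simp only: split)
      (simp add: a_def q_def right_diff_distrib left_diff_distrib sum_subtractf sum_distrib_right)
  ultimately show ?thesis by simp
qed

text \<open>The shape taken by the coupling of two neighbours: three families of joint moves indexed
  by the coordinates, and one single move. A sum type turns them into one finite index set.\<close>

lemma convex_on_jensen_three_families:
  fixes F :: "'b::real_vector \<Rightarrow> real" and w1 w2 w3 :: "'i::finite \<Rightarrow> real"
  assumes "convex_on S F" "p0 \<in> S" "\<And>k. p1 k \<in> S" "\<And>k. p2 k \<in> S" "\<And>k. p3 k \<in> S" "p4 \<in> S"
    and "\<And>k. 0 \<le> w1 k" "\<And>k. 0 \<le> w2 k" "\<And>k. 0 \<le> w3 k" "0 \<le> w4"
    and "sum w1 UNIV + sum w2 UNIV + sum w3 UNIV + w4 \<le> 1"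
  shows "F (p0 + ((\<Sum>k\<in>UNIV. w1 k *\<^sub>R (p1 k - p0)) + (\<Sum>k\<in>UNIV. w2 k *\<^sub>R (p2 k - p0))
             + (\<Sum>k\<in>UNIV. w3 k *\<^sub>R (p3 k - p0)) + w4 *\<^sub>R (p4 - p0)))
         \<le> F p0 + ((\<Sum>k\<in>UNIV. w1 k * (F (p1 k) - F p0)) + (\<Sum>k\<in>UNIV. w2 k * (F (p2 k) - F p0))
             + (\<Sum>k\<in>UNIV. w3 k * (F (p3 k) - F p0)) + w4 * (F p4 - F p0))"
proof -
  define I :: "('i + 'i + 'i + unit) set" where "I = UNIV <+> (UNIV <+> (UNIV <+> {()}))"
  define w where "w = case_sum w1 (case_sum w2 (case_sum w3 (\<lambda>_::unit. w4)))"
  define p where "p = case_sum p1 (case_sum p2 (case_sum p3 (\<lambda>_::unit. p4)))"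
  have split: "(\<Sum>k\<in>I. g k) = (\<Sum>k\<in>UNIV. g (Inl k)) + (\<Sum>k\<in>UNIV. g (Inr (Inl k)))
      + (\<Sum>k\<in>UNIV. g (Inr (Inr (Inl k)))) + g (Inr (Inr (Inr ())))"
    for g :: "('i + 'i + 'i + unit) \<Rightarrow> 'z::ab_group_add"
    unfolding I_def by (simp add: sum.Plus add.assoc)
  have "F (p0 + (\<Sum>k\<in>I. w k *\<^sub>R (p k - p0))) \<le> F p0 + (\<Sum>k\<in>I. w k * (F (p k) - F p0))"
  proof (rule convex_on_jensen_base[OF assms(1) _ assms(2)])
    show "finite I" by (simp add: I_def)
    show "sum w I \<le> 1" using assms(11) by (simp only: split) (simp add: w_def)
    show "0 \<le> w k" for k using assms(7-10) by (auto simp: w_def split: sum.split)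
    show "p k \<in> S" for k using assms(3-6) by (auto simp: p_def split: sum.split)
  qed
  then show ?thesis by (simp only: split) (simp add: w_def p_def)
qed

text \<open>The last clause is the gain from a merging move; \<open>(1 - t)\<^sup>\<alpha>\<close> is replaced by its quadratic upper bound.\<close>

definition coupling_cost :: "real \<Rightarrow> (real \<Rightarrow> real \<Rightarrow> real) \<Rightarrow> bool" where
  "coupling_cost \<alpha> P \<longleftrightarrow>
     1 \<le> \<alpha> \<and> convex_on ({0<..} \<times> {0<..}) (\<lambda>(a, b). P a b) \<and>
     (\<forall>a>0. P a a = 0) \<and> (\<forall>a>0. \<forall>b>0. P a b = P b a) \<and>
     (\<forall>a>0. \<forall>b>0. \<forall>t\<in>{0..1}.
        P (a + t * (b - a)) b \<le> (1 - \<alpha> * t + (\<alpha> - 1) * t\<^sup>2) * P a b)"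

text \<open>The points (a, b) and (b, a) have equal cost, and their midpoint lies on the diagonal,
  where the cost is 0.\<close>

lemma coupling_cost_nonneg:
  assumes "coupling_cost \<alpha> P" "a > 0" "b > 0"
  shows "0 \<le> P a b"
proof -
  have "(\<lambda>(a, b). P a b) ((1 - 1/2) *\<^sub>R (a, b) + (1/2) *\<^sub>R (b, a))
      \<le> (1 - 1/2) * (\<lambda>(a, b). P a b) (a, b) + (1/2) * (\<lambda>(a, b). P a b) (b, a)"
    using assms by (intro convex_onD[of "{0<..} \<times> {0<..}"]) (auto simp: coupling_cost_def)
  moreover have "P b a = P a b" "P (a/2+b/2) (b/2+a/2) = 0"
    using assms by (auto simp: coupling_cost_def add.commute)
  ultimately show ?thesis by simp
qed

text \<open>The quadratic cost serves to show that the iterates of the chain become constant. It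
  contracts because (1 - t)^2 \<le> 1 - t on the unit interval.\<close>

lemma coupling_cost_square: "coupling_cost 1 (\<lambda>a b. (b - a)\<^sup>2)"
proof -
  have "convex_on ({0<..} \<times> {0<..}) (\<lambda>(a, b). (b - a)\<^sup>2 :: real)"
  proof (rule convex_onI)
    fix t :: real and x y :: "real \<times> real"
    assume "0 < t" "t < 1"
    then have "((1 - t) *\<^sub>R (snd x - fst x) + t *\<^sub>R (snd y - fst y))\<^sup>2
        \<le> (1 - t) * (snd x - fst x)\<^sup>2 + t * (snd y - fst y)\<^sup>2"
      by (intro convex_onD[OF convex_power2]) auto
    then show "(case (1 - t) *\<^sub>R x + t *\<^sub>R y of (a, b) \<Rightarrow> (b - a)\<^sup>2)
        \<le> (1 - t) * (case x of (a, b) \<Rightarrow> (b - a)\<^sup>2) + t * (case y of (a, b) \<Rightarrow> (b - a)\<^sup>2)"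
      by (cases x; cases y) (simp add: algebra_simps)
  qed (simp add: convex_Times)
  moreover have "(b - (a + t * (b - a)))\<^sup>2 \<le> (1 - t) * (b - a)\<^sup>2" if "t \<in> {0..1}" for a b t :: real
  proof -
    have "(b - (a + t * (b - a)))\<^sup>2 = (1 - t) * ((1 - t) * (b - a)\<^sup>2)"
      by (simp add: power2_eq_square algebra_simps)
    also have "\<dots> \<le> (1 - t) * (b - a)\<^sup>2"
      using that by (intro mult_left_mono mult_left_le_one_le) auto
    finally show ?thesis .
  qed
  ultimately show ?thesis
    unfolding coupling_cost_def by (auto intro: power2_commute)
qed

text \<open>For rate 1 the contraction clause is convexity along the segment from (a, b) to the
  diagonal point (b, b), at which the cost vanishes.\<close>

lemma coupling_cost_oneI:
  assumes "convex_on ({0<..} \<times> {0<..}) (\<lambda>(a, b). P a b)"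
    and "\<And>a. 0 < a \<Longrightarrow> P a a = 0" "\<And>a b. 0 < a \<Longrightarrow> 0 < b \<Longrightarrow> P a b = P b a"
  shows "coupling_cost 1 P"
proof -
  have "P (a + t * (b - a)) b \<le> (1 - t) * P a b" if "0 < a" "0 < b" "t \<in> {0..1}" for a b t :: real
  proof -
    have "(\<lambda>(a, b). P a b) ((1 - t) *\<^sub>R (a, b) + t *\<^sub>R (b, b))
        \<le> (1 - t) * (\<lambda>(a, b). P a b) (a, b) + t * (\<lambda>(a, b). P a b) (b, b)"
      using that by (intro convex_onD[OF assms(1)]) auto
    moreover have "(1 - t) *\<^sub>R (a, b) + t *\<^sub>R (b, b) = (a + t * (b - a), b)"
      by (simp add: algebra_simps)
    ultimately show ?thesis using assms(2) that by simp
  qed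
  then show ?thesis unfolding coupling_cost_def using assms by auto
qed

section \<open>Hessian test and the admissible, logarithmic and Beckner entropies\<close>

lemma convex_on_increment_product:
  fixes \<psi> \<psi>' \<psi>'' :: "real \<Rightarrow> real"
  assumes d1: "\<And>a. 0 < a \<Longrightarrow> (\<psi> has_real_derivative \<psi>' a) (at a)"
    and d2: "\<And>a. 0 < a \<Longrightarrow> (\<psi>' has_real_derivative \<psi>'' a) (at a)"
    and hess: "\<And>a b v w. 0 < a \<Longrightarrow> 0 < b \<Longrightarrow>
      0 \<le> (\<psi>'' b * w\<^sup>2 - \<psi>'' a * v\<^sup>2) * (b - a) + 2 * (\<psi>' b * w - \<psi>' a * v) * (w - v)"
  shows "convex_on ({0<..} \<times> {0<..}) (\<lambda>(a, b). (\<psi> b - \<psi> a) * (b - a))"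
proof (rule convex_onI)
  fix t :: real and x y :: "real \<times> real"
  assume t: "0 < t" "t < 1" and xy: "x \<in> {0<..} \<times> {0<..}" "y \<in> {0<..} \<times> {0<..}"
  \<comment> \<open>Restriction to the segment from \<open>x\<close> to \<open>y\<close> leaves one
    variable; the second derivative there is the Hessian form in direction (v, w), whose sign is
    \<open>hess\<close>.\<close>
  define a where "a = (\<lambda>s. fst x + s * (fst y - fst x))"
  define b where "b = (\<lambda>s. snd x + s * (snd y - snd x))"
  define v where "v = fst y - fst x"
  define w where "w = snd y - snd x"
  have ab: "0 < a s" "0 < b s" if "s \<in> {0..1}" for s
    using that xy segment_pos by (auto simp: a_def b_def mem_Times_iff)
  have da: "(a has_real_derivative v) (at s)" and db: "(b has_real_derivative w) (at s)" for s
    unfolding a_def b_def v_def w_def by (auto intro!: derivative_eq_intros)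
  have chain: "((\<lambda>s. g (a s)) has_real_derivative g' (a s) * v) (at s)"
     "((\<lambda>s. g (b s)) has_real_derivative g' (b s) * w) (at s)"
    if "\<And>a. 0 < a \<Longrightarrow> (g has_real_derivative g' a) (at a)" "s \<in> {0..1}" for g g' s
    using that ab[of s] DERIV_chain2[OF _ da] DERIV_chain2[OF _ db] by blast+
  have "convex_on {0..1} (\<lambda>s. (\<psi> (b s) - \<psi> (a s)) * (b s - a s))"
  proof (rule f''_ge0_imp_convex)
    fix s :: real assume s: "s \<in> {0..1}"
    show "((\<lambda>s. (\<psi> (b s) - \<psi> (a s)) * (b s - a s)) has_real_derivative
        (\<psi>' (b s) * w - \<psi>' (a s) * v) * (b s - a s) + (\<psi> (b s) - \<psi> (a s)) * (w - v)) (at s)"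
      by (rule derivative_eq_intros chain[OF d1 s] da db refl | assumption)+ (simp add: algebra_simps)
    show "((\<lambda>s. (\<psi>' (b s) * w - \<psi>' (a s) * v) * (b s - a s) + (\<psi> (b s) - \<psi> (a s)) * (w - v))
        has_real_derivative
        (\<psi>'' (b s) * w\<^sup>2 - \<psi>'' (a s) * v\<^sup>2) * (b s - a s) + 2 * (\<psi>' (b s) * w - \<psi>' (a s) * v) * (w - v)) (at s)"
      by (rule derivative_eq_intros chain[OF d1 s] chain[OF d2 s] da db refl | assumption)+
        (simp add: algebra_simps power2_eq_square)
    show "0 \<le> (\<psi>'' (b s) * w\<^sup>2 - \<psi>'' (a s) * v\<^sup>2) * (b s - a s) + 2 * (\<psi>' (b s) * w - \<psi>' (a s) * v) * (w - v)"
      by (rule hess[OF ab[OF s]])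
  qed simp
  from convex_onD[OF this, of t 0 1] t
  show "(case (1 - t) *\<^sub>R x + t *\<^sub>R y of (a, b) \<Rightarrow> (\<psi> b - \<psi> a) * (b - a))
      \<le> (1 - t) * (case x of (a, b) \<Rightarrow> (\<psi> b - \<psi> a) * (b - a)) + t * (case y of (a, b) \<Rightarrow> (\<psi> b - \<psi> a) * (b - a))"
    by (cases x; cases y) (simp add: a_def b_def algebra_simps)
qed (simp add: convex_Times)

text \<open>What the functional inequality uses of an entropy, all of it at positive arguments: the
  coupling properties of \<open>Phi\<close> with rate \<alpha>, and tangent lines below the graph,
  which control the entropy loss in one discrete step.\<close>

definition sobolev_cost :: "real \<Rightarrow> (real \<Rightarrow> real) \<Rightarrow> bool" where
  "sobolev_cost \<alpha> \<phi> \<longleftrightarrow> coupling_cost \<alpha> (Phi \<phi>) \<and>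
     (\<forall>a>0. 0 \<le> \<phi> a \<and> isCont \<phi> a \<and> (\<forall>x>0. \<phi> a + deriv \<phi> a * (x - a) \<le> \<phi> x))"

lemma admissible_imp_sobolev_cost:
  assumes "admissible \<phi>"
  shows "sobolev_cost 1 \<phi>"
proof -
  have "coupling_cost 1 (Phi \<phi>)"
    using assms by (intro coupling_cost_oneI) (auto simp: admissible_def Phi_def algebra_simps)
  moreover have "isCont \<phi> a" if "0 < a" for a
    using assms that by (auto simp: admissible_def intro: differentiable_imp_continuous_within)
  moreover have "\<phi> a + deriv \<phi> a * (x - a) \<le> \<phi> x" if "0 < a" "0 < x" for a x
  proof -
    have "(\<phi> has_real_derivative deriv \<phi> a) (at a)"
      using assms that by (simp add: admissible_def DERIV_deriv_iff_real_differentiable)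
    then have "deriv \<phi> a * (x - a) \<le> \<phi> x - \<phi> a"
      using assms that
      by (intro convex_on_imp_above_tangent[of "{0..}"])
        (auto simp: admissible_def intro: has_field_derivative_at_within)
    then show ?thesis by simp
  qed
  ultimately show ?thesis using assms by (auto simp: sobolev_cost_def admissible_def)
qed

lemma convex_on_eq_on:
  assumes "convex_on S f" "\<And>x. x \<in> S \<Longrightarrow> g x = f x"
  shows "convex_on S g"
proof (rule convex_onI)
  show S: "convex S" using assms(1) by (rule convex_on_imp_convex)
  show "g ((1 - t) *\<^sub>R x + t *\<^sub>R y) \<le> (1 - t) * g x + t * g y"
    if "0 < t" "t < 1" "x \<in> S" "y \<in> S" for t x y
    using that convex_onD[OF assms(1), of t x y] convexD_alt[OF S, of x y t] by (simp add: assms(2))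
qed

text \<open>Replaces \<open>deriv\<close> by an explicit derivative; the two versions of
  \<open>Phi\<close> are compared on the open quadrant. The normalisation at 1 makes the tangent
  there the zero line, so that nonnegativity follows from the tangent inequality.\<close>

lemma sobolev_costI:
  assumes P: "coupling_cost \<alpha> (\<lambda>a b. (\<psi> b - \<psi> a) * (b - a))"
    and d1: "\<And>a. 0 < a \<Longrightarrow> (\<phi> has_real_derivative \<psi> a) (at a)"
    and d2: "\<And>a. 0 < a \<Longrightarrow> (\<psi> has_real_derivative \<psi>' a) (at a)"
    and "\<And>a. 0 < a \<Longrightarrow> 0 \<le> \<psi>' a" "\<phi> 1 = 0" "\<psi> 1 = 0"
  shows "sobolev_cost \<alpha> \<phi>"
proof -
  have deriv: "deriv \<phi> a = \<psi> a" if "0 < a" for a using d1[OF that] by (rule DERIV_imp_deriv)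
  have tangent: "\<psi> a * (x - a) \<le> \<phi> x - \<phi> a" if "0 < a" "0 < x" for a x
    using assms that by (intro f''_imp_f'[of "{0<..}" \<phi> \<psi> \<psi>']) auto
  have eq: "(\<lambda>(a, b). Phi \<phi> a b) x = (\<lambda>(a, b). (\<psi> b - \<psi> a) * (b - a)) x" if "x \<in> {0<..} \<times> {0<..}" for x
    using that by (auto simp: Phi_def deriv)
  have "convex_on ({0<..} \<times> {0<..}) (\<lambda>(a, b). Phi \<phi> a b)"
    by (rule convex_on_eq_on[OF _ eq]) (use P in \<open>simp_all add: coupling_cost_def\<close>)
  then have "coupling_cost \<alpha> (Phi \<phi>)"
    using P by (auto simp: coupling_cost_def Phi_def deriv segment_pos)
  moreover have "isCont \<phi> a" if "0 < a" for a using d1[OF that] by (rule DERIV_isCont)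
  ultimately show ?thesis
    using tangent tangent[of 1] assms(5,6) by (auto simp: sobolev_cost_def deriv) (smt (verit) tangent)
qed

lemma sobolev_cost_phi_log: "sobolev_cost 1 phi_log"
proof (rule sobolev_costI)
  show "(phi_log has_real_derivative ln a) (at a)" if "0 < a" for a
    unfolding phi_log_def[abs_def] using that by (auto intro!: derivative_eq_intros)
  show dln: "(ln has_real_derivative 1 / a) (at a)" if "0 < a" for a :: real
    using that by (auto intro!: derivative_eq_intros)
  show "coupling_cost 1 (\<lambda>a b. (ln b - ln a) * (b - a))"
  proof (rule coupling_cost_oneI)
    show "convex_on ({0<..} \<times> {0<..}) (\<lambda>(a, b). (ln b - ln a) * (b - a :: real))"
    proof (rule convex_on_increment_product)
      show "((\<lambda>a. 1 / a) has_real_derivative - 1 / a\<^sup>2) (at a)" if "0 < a" for a :: real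
        using that by (auto intro!: derivative_eq_intros simp: power2_eq_square)
      fix a b v w :: real assume "0 < a" "0 < b"
      \<comment> \<open>The Hessian form collapses to a single square.\<close>
      then have "(- 1 / b\<^sup>2 * w\<^sup>2 - - 1 / a\<^sup>2 * v\<^sup>2) * (b - a) + 2 * (1 / b * w - 1 / a * v) * (w - v)
          = (a + b) * (w / b - v / a)\<^sup>2"
        by (simp add: field_simps power2_eq_square)
      then show "0 \<le> (- 1 / b\<^sup>2 * w\<^sup>2 - - 1 / a\<^sup>2 * v\<^sup>2) * (b - a) + 2 * (1 / b * w - 1 / a * v) * (w - v)"
        using \<open>0 < a\<close> \<open>0 < b\<close> by simp
    qed (rule dln)
  qed (auto simp: algebra_simps)
qed (auto simp: phi_log_def)

text \<open>Concavity of the power: the derivative of the increment in its starting point is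
  nonpositive, since the exponent \<beta> - 1 is.\<close>

lemma powr_increment_antimono:
  fixes x y h \<beta> :: real
  assumes "0 < x" "x \<le> y" "0 \<le> h" "0 \<le> \<beta>" "\<beta> \<le> 1"
  shows "(y + h) powr \<beta> - y powr \<beta> \<le> (x + h) powr \<beta> - x powr \<beta>"
proof (rule DERIV_nonpos_imp_nonincreasing[OF assms(2)])
  fix z assume z: "x \<le> z" "z \<le> y"
  then have "((\<lambda>z. (z + h) powr \<beta> - z powr \<beta>) has_real_derivative
      \<beta> * (z + h) powr (\<beta> - 1) - \<beta> * z powr (\<beta> - 1)) (at z)"
    using assms by (auto intro!: derivative_eq_intros)
  moreover have "(z + h) powr (\<beta> - 1) \<le> z powr (\<beta> - 1)"
    using assms z by (intro powr_mono2') auto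
  ultimately show "\<exists>d. ((\<lambda>z. (z + h) powr \<beta> - z powr \<beta>) has_real_derivative d) (at z) \<and> d \<le> 0"
    using assms(4) by (intro exI conjI) (assumption, simp add: mult_left_mono)
qed

lemma convex_on_powr_increment_product:
  fixes \<beta> :: real
  assumes "0 < \<beta>" "\<beta> \<le> 1"
  shows "convex_on ({0<..} \<times> {0<..}) (\<lambda>(a, b). (b powr \<beta> - a powr \<beta>) * (b - a))"
proof (rule convex_on_increment_product)
  show "((\<lambda>a. a powr \<beta>) has_real_derivative \<beta> * a powr (\<beta> - 1)) (at a)" if "0 < a" for a
    using that by (rule has_real_derivative_powr)
  show "((\<lambda>a. \<beta> * a powr (\<beta> - 1)) has_real_derivative \<beta> * ((\<beta> - 1) * a powr (\<beta> - 2))) (at a)"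
    if "0 < a" for a
    using DERIV_cmult[OF has_real_derivative_powr[OF that, of "\<beta> - 1"], of \<beta>] by simp
  fix a b v w :: real assume ab: "0 < a" "0 < b"
  define A where "A = a powr \<beta>"
  define B where "B = b powr \<beta>"
  have AB: "0 < A" "0 < B" using ab by (simp_all add: A_def B_def)
  have pw: "a powr (\<beta> - 1) = A / a" "a powr (\<beta> - 2) = A / a\<^sup>2" "b powr (\<beta> - 1) = B / b" "b powr (\<beta> - 2) = B / b\<^sup>2"
    using ab by (simp_all add: A_def B_def powr_diff)
  \<comment> \<open>In the logarithmic directions \<open>W = w / b\<close> and
    \<open>V = v / a\<close>, with the factor \<beta> taken out, the Hessian form has diagonal
    coefficients \<open>p\<close>, \<open>q\<close> and mixed coefficient \<open>- 2 * r\<close>. It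
    is nonnegative once \<open>p\<close> is positive and the square of \<open>r\<close> is at most
    \<open>p * q\<close>.\<close>
  define p where "p = B * ((1 + \<beta>) * b + (1 - \<beta>) * a)"
  define q where "q = A * ((1 + \<beta>) * a + (1 - \<beta>) * b)"
  define r where "r = A * b + B * a"
  define W where "W = w / b"
  define V where "V = v / a"
  have wv: "w = b * W" "v = a * V" using ab by (simp_all add: W_def V_def)
  have "(\<beta> * ((\<beta> - 1) * b powr (\<beta> - 2)) * w\<^sup>2 - \<beta> * ((\<beta> - 1) * a powr (\<beta> - 2)) * v\<^sup>2) * (b - a)
       + 2 * (\<beta> * b powr (\<beta> - 1) * w - \<beta> * a powr (\<beta> - 1) * v) * (w - v)
       = \<beta> * (p * W\<^sup>2 + q * V\<^sup>2 - 2 * r * V * W)"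
    unfolding pw wv p_def q_def r_def using ab by (simp add: field_simps power2_eq_square)
  moreover have p: "0 < p" using ab AB assms by (simp add: p_def add_pos_nonneg)
  moreover have "r\<^sup>2 \<le> p * q"
  proof -
    \<comment> \<open>Weighted arithmetic-geometric mean of \<open>x / y\<close> and 1. Applied in
      both orders of \<open>a\<close> and \<open>b\<close>, it bounds the two terms of the square of
      \<open>r\<close>, divided by \<open>A * B\<close>, that contain quotients of powers.\<close>
    have young: "(x / y) powr \<beta> * y\<^sup>2 \<le> \<beta> * (x * y) + (1 - \<beta>) * y\<^sup>2" if "0 < x" "0 < y" for x y :: real
    proof -
      have "(x / y) powr \<beta> * 1 powr (1 - \<beta>) \<le> \<beta> * (x / y) + (1 - \<beta>) * 1"
        using assms that by (intro Youngs_inequality_0) auto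
      then have "(x / y) powr \<beta> * y\<^sup>2 \<le> (\<beta> * (x / y) + (1 - \<beta>)) * y\<^sup>2" by (intro mult_right_mono) auto
      moreover have "(\<beta> * (x / y) + (1 - \<beta>)) * y\<^sup>2 = \<beta> * (x * y) + (1 - \<beta>) * y\<^sup>2"
        using that by (simp add: field_simps power2_eq_square)
      ultimately show ?thesis by simp
    qed
    have "A / B * b\<^sup>2 + B / A * a\<^sup>2 \<le> (1 - \<beta>) * (a\<^sup>2 + b\<^sup>2) + 2 * \<beta> * (a * b)"
      using young[OF ab] young[OF ab(2,1)] ab
      by (simp add: A_def B_def powr_divide algebra_simps)
    also have "\<dots> \<le> (a + b)\<^sup>2 - \<beta>\<^sup>2 * (b - a)\<^sup>2 - 2 * a * b"
    proof -
      have "(a + b)\<^sup>2 - \<beta>\<^sup>2 * (b - a)\<^sup>2 - 2 * a * b - ((1 - \<beta>) * (a\<^sup>2 + b\<^sup>2) + 2 * \<beta> * (a * b))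
          = \<beta> * (1 - \<beta>) * (b - a)\<^sup>2" by (simp add: power2_eq_square algebra_simps)
      moreover have "0 \<le> \<beta> * (1 - \<beta>) * (b - a)\<^sup>2" using assms by simp
      ultimately show ?thesis by linarith
    qed
    finally have "A * B * (A / B * b\<^sup>2 + B / A * a\<^sup>2 + 2 * a * b) \<le> A * B * ((a + b)\<^sup>2 - \<beta>\<^sup>2 * (b - a)\<^sup>2)"
      using AB by (intro mult_left_mono) auto
    moreover have "A * B * (A / B * b\<^sup>2 + B / A * a\<^sup>2 + 2 * a * b) = r\<^sup>2"
      using AB by (simp add: r_def field_simps power2_eq_square)
    moreover have "A * B * ((a + b)\<^sup>2 - \<beta>\<^sup>2 * (b - a)\<^sup>2) = p * q"
      by (simp add: p_def q_def power2_eq_square algebra_simps)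
    ultimately show ?thesis by simp
  qed
  moreover have "p * (p * W\<^sup>2 + q * V\<^sup>2 - 2 * r * V * W) = (p * W - r * V)\<^sup>2 + (p * q - r\<^sup>2) * V\<^sup>2"
    by (simp add: power2_eq_square algebra_simps)
  ultimately have "0 \<le> p * (p * W\<^sup>2 + q * V\<^sup>2 - 2 * r * V * W)" by simp
  then have "0 \<le> p * W\<^sup>2 + q * V\<^sup>2 - 2 * r * V * W" using p by (simp add: zero_le_mult_iff)
  then show "0 \<le> (\<beta> * ((\<beta> - 1) * b powr (\<beta> - 2)) * w\<^sup>2 - \<beta> * ((\<beta> - 1) * a powr (\<beta> - 2)) * v\<^sup>2) * (b - a)
       + 2 * (\<beta> * b powr (\<beta> - 1) * w - \<beta> * a powr (\<beta> - 1) * v) * (w - v)"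
    unfolding \<open>_ = \<beta> * (p * W\<^sup>2 + q * V\<^sup>2 - 2 * r * V * W)\<close> using assms by simp
qed

text \<open>Let \<theta> = 1 - t be the remaining fraction. The power increment between c and b is
  compared with the one between \<theta> a and \<theta> b, an interval of the same length closer to
  0; homogeneity gives the factor \<theta>^\<beta>. The factor b - c gives one more \<theta>, and
  \<theta>^(1 + \<beta>) lies below the quadratic in t.\<close>

lemma powr_increment_product_contraction:
  fixes \<beta> :: real
  assumes \<beta>: "0 < \<beta>" "\<beta> \<le> 1" and ab: "0 < a" "0 < b" and t: "t \<in> {0..1}"
  defines "c \<equiv> a + t * (b - a)"
  shows "(b powr \<beta> - c powr \<beta>) * (b - c)
    \<le> (1 - (1 + \<beta>) * t + \<beta> * t\<^sup>2) * ((b powr \<beta> - a powr \<beta>) * (b - a))"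
proof (cases "t = 1")
  case False
  define \<theta> where "\<theta> = 1 - t"
  have \<theta>: "0 < \<theta>" "\<theta> \<le> 1" using t False by (auto simp: \<theta>_def)
  have c: "c = \<theta> * a + (1 - \<theta>) * b" "b - c = \<theta> * (b - a)" by (simp_all add: c_def \<theta>_def algebra_simps)
  \<comment> \<open>Weighted arithmetic-geometric mean of \<theta> and its square; written in t, the
    right-hand side is the quadratic of \<open>coupling_cost\<close> with \<alpha> = 1 +
    \<beta>.\<close>
  have "\<theta> powr (1 - \<beta>) * (\<theta>\<^sup>2) powr \<beta> \<le> (1 - \<beta>) * \<theta> + \<beta> * \<theta>\<^sup>2"
    using \<theta> \<beta> by (intro Youngs_inequality_0) auto
  moreover have "\<theta> powr (1 - \<beta>) * (\<theta>\<^sup>2) powr \<beta> = \<theta> * \<theta> powr \<beta>"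
    using \<theta> by (simp add: power2_eq_square powr_mult powr_diff)
  ultimately have young: "\<theta> * \<theta> powr \<beta> \<le> 1 - (1 + \<beta>) * t + \<beta> * t\<^sup>2"
    by (simp add: \<theta>_def power2_eq_square algebra_simps)
  have "(b powr \<beta> - c powr \<beta>) * (b - a) \<le> \<theta> powr \<beta> * (b powr \<beta> - a powr \<beta>) * (b - a)"
  proof (cases "a \<le> b")
    case True
    have "(c + \<theta> * (b - a)) powr \<beta> - c powr \<beta> \<le> (\<theta> * a + \<theta> * (b - a)) powr \<beta> - (\<theta> * a) powr \<beta>"
      using \<theta> \<beta> ab True by (intro powr_increment_antimono) (auto simp: c)
    moreover have "c + \<theta> * (b - a) = b" "\<theta> * a + \<theta> * (b - a) = \<theta> * b"
      using c by (simp_all add: algebra_simps)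
    ultimately have "b powr \<beta> - c powr \<beta> \<le> \<theta> powr \<beta> * (b powr \<beta> - a powr \<beta>)"
      using \<theta> ab by (simp add: powr_mult algebra_simps)
    then show ?thesis using True by (intro mult_right_mono) auto
  next
    case False
    have "(b + \<theta> * (a - b)) powr \<beta> - b powr \<beta> \<le> (\<theta> * b + \<theta> * (a - b)) powr \<beta> - (\<theta> * b) powr \<beta>"
      using \<theta> \<beta> ab False by (intro powr_increment_antimono) (auto simp: mult_left_le_one_le)
    moreover have "b + \<theta> * (a - b) = c" "\<theta> * b + \<theta> * (a - b) = \<theta> * a"
      by (simp_all add: c algebra_simps)
    ultimately have "\<theta> powr \<beta> * (b powr \<beta> - a powr \<beta>) \<le> b powr \<beta> - c powr \<beta>"
      using \<theta> ab by (simp add: powr_mult algebra_simps)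
    then show ?thesis using False by (intro mult_right_mono_neg) auto
  qed
  then have "\<theta> * ((b powr \<beta> - c powr \<beta>) * (b - a)) \<le> \<theta> * (\<theta> powr \<beta> * (b powr \<beta> - a powr \<beta>) * (b - a))"
    using \<theta> by (intro mult_left_mono) auto
  also have "\<dots> = \<theta> * \<theta> powr \<beta> * ((b powr \<beta> - a powr \<beta>) * (b - a))" by simp
  also have "\<dots> \<le> (1 - (1 + \<beta>) * t + \<beta> * t\<^sup>2) * ((b powr \<beta> - a powr \<beta>) * (b - a))"
  proof (rule mult_right_mono[OF young])
    show "0 \<le> (b powr \<beta> - a powr \<beta>) * (b - a)"
      using \<beta> ab powr_mono2[of \<beta> a b] powr_mono2[of \<beta> b a] by (simp add: zero_le_mult_iff) linarith
  qed
  finally show ?thesis by (simp add: c(2) mult.left_commute)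
qed (simp add: c_def)

text \<open>The derivative is affine in a^(\<alpha> - 1), so \<open>Phi\<close> is a positive
  multiple of the power cost with exponent \<beta> = \<alpha> - 1, whose contraction rate is 1 +
  \<beta> = \<alpha>.\<close>

lemma sobolev_cost_phi_beckner:
  assumes \<alpha>: "1 < \<alpha>" "\<alpha> \<le> 2"
  shows "sobolev_cost \<alpha> (phi_beckner \<alpha>)"
proof (rule sobolev_costI)
  define \<beta> where "\<beta> = \<alpha> - 1"
  have \<beta>: "0 < \<beta>" "\<beta> \<le> 1" "\<alpha> = 1 + \<beta>" using \<alpha> by (auto simp: \<beta>_def)
  let ?\<psi> = "\<lambda>a. 1 / (\<alpha> - 1) * (\<alpha> * a powr (\<alpha> - 1) - 1) - 1"
  show "(phi_beckner \<alpha> has_real_derivative ?\<psi> a) (at a)" if "0 < a" for a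
    unfolding phi_beckner_def[abs_def] using that \<alpha> by (auto intro!: derivative_eq_intros)
  show "(?\<psi> has_real_derivative \<alpha> * a powr (\<alpha> - 2)) (at a)" if "0 < a" for a
  proof -
    have "(?\<psi> has_real_derivative 1 / (\<alpha> - 1) * (\<alpha> * ((\<alpha> - 1) * a powr (\<alpha> - 1 - 1)) - 0) - 0) (at a)"
      by (intro DERIV_diff DERIV_cmult DERIV_const has_real_derivative_powr that)
    then show ?thesis using \<alpha> by simp
  qed
  have eq: "(?\<psi> b - ?\<psi> a) * (b - a) = \<alpha> / \<beta> * ((b powr \<beta> - a powr \<beta>) * (b - a))" for a b
    by (simp add: \<beta>_def add_divide_distrib diff_divide_distrib algebra_simps)
  have k: "0 \<le> \<alpha> / \<beta>" using \<beta> by simp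
  show "coupling_cost \<alpha> (\<lambda>a b. (?\<psi> b - ?\<psi> a) * (b - a))"
    unfolding eq coupling_cost_def
  proof (intro conjI allI impI ballI)
    show "1 \<le> \<alpha>" using \<alpha> by simp
    show "convex_on ({0<..} \<times> {0<..}) (\<lambda>(a, b). \<alpha> / \<beta> * ((b powr \<beta> - a powr \<beta>) * (b - a)))"
      using convex_on_cmul[OF k convex_on_powr_increment_product[OF \<beta>(1,2)]]
      by (simp add: case_prod_unfold)
  next
    fix a b t :: real assume *: "0 < a" "0 < b" "t \<in> {0..1}"
    show "\<alpha> / \<beta> * ((b powr \<beta> - (a + t * (b - a)) powr \<beta>) * (b - (a + t * (b - a))))
      \<le> (1 - \<alpha> * t + (\<alpha> - 1) * t\<^sup>2) * (\<alpha> / \<beta> * ((b powr \<beta> - a powr \<beta>) * (b - a)))"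
      using mult_left_mono[OF powr_increment_product_contraction[OF \<beta>(1,2) *] k]
      by (simp add: \<beta>(3) mult_ac)
  qed (auto simp: algebra_simps)
qed (use \<alpha> in \<open>auto simp: phi_beckner_def field_simps\<close>)

section \<open>Birth and death chains on a finite box\<close>

lemma nat_vec_induct [case_names zero up]:
  fixes \<eta> :: "nat ^ 'd::finite"
  assumes "P 0" "\<And>\<eta> i. P \<eta> \<Longrightarrow> P (\<eta> + axis i 1)"
  shows "P \<eta>"
proof (induction "\<Sum>i\<in>UNIV. \<eta> $ i" arbitrary: \<eta> rule: less_induct)
  case less
  show ?case
  proof (cases "\<eta> = 0")
    case False
    then obtain i where i: "0 < \<eta> $ i" by (auto simp: vec_eq_iff)
    define \<xi> where "\<xi> = \<eta> - axis i 1"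
    have \<eta>: "\<eta> = \<xi> + axis i 1" using i by (auto simp: \<xi>_def vec_eq_iff axis_def)
    have "(\<Sum>j\<in>UNIV. \<xi> $ j) < (\<Sum>j\<in>UNIV. \<eta> $ j)"
      using i by (intro sum_strict_mono_ex1) (auto simp: \<xi>_def axis_def)
    then show ?thesis using less assms(2) \<eta> by metis
  qed (simp add: assms(1))
qed

text \<open>The chain with killed births in abstract form. The reversible weight \<open>u\<close>
  stays unnormalised because a truncated probability has in general mass below 1. As
  \<open>u\<close> vanishes outside \<open>X\<close>, \<open>balance\<close> forces births that
  leave \<open>X\<close> to have rate 0. Monotonicity, \<open>gap\<close> and \<open>curv\<close>
  concern edges inside \<open>X\<close>.\<close>

locale birth_death_box =
  fixes X :: "(nat ^ 'd::finite) set" and u :: "nat ^ 'd \<Rightarrow> real"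
    and B :: "'d \<Rightarrow> nat ^ 'd \<Rightarrow> real" and lam k :: real
  assumes fin: "finite X" and zero_in: "0 \<in> X"
    and down_closed: "\<eta> + axis i 1 \<in> X \<Longrightarrow> \<eta> \<in> X"
    and lam_pos: "0 < lam"
    and u_pos: "\<eta> \<in> X \<Longrightarrow> 0 < u \<eta>" and u_out: "\<eta> \<notin> X \<Longrightarrow> u \<eta> = 0"
    and B_nonneg: "0 \<le> B i \<eta>"
    and balance: "\<eta> \<in> X \<Longrightarrow> u \<eta> * B i \<eta> = u (\<eta> + axis i 1) * (lam * (real (\<eta> $ i) + 1))"
    and B_mono: "\<eta> + axis i 1 \<in> X \<Longrightarrow> B j (\<eta> + axis i 1) \<le> B j \<eta>"
    and gap: "\<eta> + axis i 1 \<in> X \<Longrightarrow>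
      (\<Sum>j\<in>UNIV - {i}. B j \<eta> - B j (\<eta> + axis i 1)) \<le> lam"
    and curv: "\<eta> + axis i 1 \<in> X \<Longrightarrow>
      k \<le> lam + (B i \<eta> - B i (\<eta> + axis i 1)) - (\<Sum>j\<in>UNIV - {i}. B j \<eta> - B j (\<eta> + axis i 1))"
begin

section \<open>Generator, detailed balance and energy on the box\<close>

definition gen :: "(nat ^ 'd \<Rightarrow> real) \<Rightarrow> nat ^ 'd \<Rightarrow> real" where
  "gen f \<eta> = (\<Sum>j\<in>UNIV. B j \<eta> * (f (\<eta> + axis j 1) - f \<eta>))
           + (\<Sum>j\<in>UNIV. lam * real (\<eta> $ j) * (f (\<eta> - axis j 1) - f \<eta>))"

text \<open>The matrix 1 + e L on \<open>X\<close>; outside it acts as the identity, so that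
  positive functions on the whole lattice stay positive.\<close>

definition step :: "real \<Rightarrow> (nat ^ 'd \<Rightarrow> real) \<Rightarrow> nat ^ 'd \<Rightarrow> real" where
  "step e f \<eta> = (if \<eta> \<in> X then f \<eta> + e * gen f \<eta> else f \<eta>)"

text \<open>Each edge is counted once, through its birth; the sum over births and deaths is twice
  this.\<close>

definition energy :: "(real \<Rightarrow> real \<Rightarrow> real) \<Rightarrow> (nat ^ 'd \<Rightarrow> real) \<Rightarrow> real" where
  "energy P f = (\<Sum>\<eta>\<in>X. \<Sum>i\<in>UNIV. u \<eta> * B i \<eta> * P (f \<eta>) (f (\<eta> + axis i 1)))"

lemma weight_boundary: "\<eta> \<in> X \<Longrightarrow> \<eta> + axis i 1 \<notin> X \<Longrightarrow> B i \<eta> = 0"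
  using balance[of \<eta> i] u_pos[of \<eta>] u_out[of "\<eta> + axis i 1"] by auto

text \<open>Detailed balance as a change of variables: a death in direction \<open>j\<close> is the
  reversed birth at the lower endpoint of the same edge.\<close>

lemma exchange:
  "(\<Sum>\<eta>\<in>X. u \<eta> * (lam * real (\<eta> $ j)) * h (\<eta> - axis j 1) \<eta>)
     = (\<Sum>\<eta>\<in>X. u \<eta> * B j \<eta> * h \<eta> (\<eta> + axis j 1))"
proof -
  have shift: "\<eta> - axis j 1 + axis j 1 = \<eta>" if "0 < \<eta> $ j" for \<eta> :: "nat ^ 'd"
    using that by (auto simp: vec_eq_iff axis_def)
  \<comment> \<open>At \<open>\<eta> $ j = 0\<close> truncated subtraction leaves \<eta> in place,
    but there the death rate is 0.\<close>
  have "(\<Sum>\<eta>\<in>X. u \<eta> * (lam * real (\<eta> $ j)) * h (\<eta> - axis j 1) \<eta>)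
      = (\<Sum>\<eta>\<in>{\<eta>\<in>X. 0 < \<eta> $ j}. u \<eta> * (lam * real (\<eta> $ j)) * h (\<eta> - axis j 1) \<eta>)"
    by (rule sum.mono_neutral_right) (auto simp: fin)
  also have "\<dots> = (\<Sum>\<eta>\<in>{\<eta>\<in>X. \<eta> + axis j 1 \<in> X}. u \<eta> * B j \<eta> * h \<eta> (\<eta> + axis j 1))"
  proof (rule sum.reindex_bij_witness[where i = "\<lambda>\<eta>. \<eta> + axis j 1" and j = "\<lambda>\<eta>. \<eta> - axis j 1"])
    fix \<eta> assume "\<eta> \<in> {\<eta>\<in>X. 0 < \<eta> $ j}"
    then have x: "\<eta> \<in> X" "0 < \<eta> $ j" by auto
    show "\<eta> - axis j 1 + axis j 1 = \<eta>" using shift x by simp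
    then have in_X: "\<eta> - axis j 1 \<in> X" using x down_closed by metis
    then show "\<eta> - axis j 1 \<in> {\<eta>\<in>X. \<eta> + axis j 1 \<in> X}" using shift x by auto
    show "u (\<eta> - axis j 1) * B j (\<eta> - axis j 1) * h (\<eta> - axis j 1) (\<eta> - axis j 1 + axis j 1)
        = u \<eta> * (lam * real (\<eta> $ j)) * h (\<eta> - axis j 1) \<eta>"
      using balance[OF in_X, of j] x
      by (simp add: shift of_nat_diff Suc_leI flip: One_nat_def)
  qed (auto simp: axis_def)
  also have "\<dots> = (\<Sum>\<eta>\<in>X. u \<eta> * B j \<eta> * h \<eta> (\<eta> + axis j 1))"
    by (rule sum.mono_neutral_left) (auto simp: fin weight_boundary)
  finally show ?thesis .
qed

text \<open>The death half is turned into births by \<open>exchange\<close>, with the two endpoints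
  swapped.\<close>

lemma sum_gen_by_parts:
  "(\<Sum>\<eta>\<in>X. u \<eta> * (g \<eta> * gen f \<eta>))
     = - (\<Sum>\<eta>\<in>X. \<Sum>i\<in>UNIV. u \<eta> * B i \<eta> *
           ((g (\<eta> + axis i 1) - g \<eta>) * (f (\<eta> + axis i 1) - f \<eta>)))"
proof -
  have "(\<Sum>\<eta>\<in>X. u \<eta> * (g \<eta> * gen f \<eta>))
     = (\<Sum>i\<in>UNIV. \<Sum>\<eta>\<in>X. u \<eta> * B i \<eta> * (g \<eta> * (f (\<eta> + axis i 1) - f \<eta>)))
     + (\<Sum>i\<in>UNIV. \<Sum>\<eta>\<in>X. u \<eta> * (lam * real (\<eta> $ i)) * (g \<eta> * (f (\<eta> - axis i 1) - f \<eta>)))"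
    unfolding gen_def
    by (simp add: sum.swap[of _ UNIV X] sum_distrib_left distrib_left sum.distrib mult_ac)
  also have "(\<Sum>i\<in>UNIV. \<Sum>\<eta>\<in>X. u \<eta> * (lam * real (\<eta> $ i)) * (g \<eta> * (f (\<eta> - axis i 1) - f \<eta>)))
     = (\<Sum>i\<in>UNIV. \<Sum>\<eta>\<in>X. u \<eta> * B i \<eta> * (g (\<eta> + axis i 1) * (f \<eta> - f (\<eta> + axis i 1))))"
    by (rule sum.cong[OF refl], rule exchange[where h = "\<lambda>\<xi> \<eta>. g \<eta> * (f \<xi> - f \<eta>)"])
  finally show ?thesis
    by (subst sum.swap) (simp add: sum.distrib[symmetric] sum_negf[symmetric] algebra_simps)
qed

text \<open>Kolmogorov's cycle condition on a lattice square: multiplied by \<open>u \<eta>\<close>,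
  both products equal the weight of the top corner times the two death rates leading back down. If
  the top corner lies outside \<open>X\<close>, both vanish.\<close>

lemma B_commute:
  assumes "\<eta> \<in> X"
  shows "B i \<eta> * B j (\<eta> + axis i 1) = B j \<eta> * B i (\<eta> + axis j 1)"
proof -
  have two: "u \<eta> * (B i \<eta> * B j (\<eta> + axis i 1)) =
      u (\<eta> + axis i 1 + axis j 1) * (lam * (real ((\<eta> + axis i 1) $ j) + 1)) * (lam * (real (\<eta> $ i) + 1))"
    for i j
  proof (cases "\<eta> + axis i 1 \<in> X")
    case True
    have "u \<eta> * (B i \<eta> * B j (\<eta> + axis i 1)) = (u \<eta> * B i \<eta>) * B j (\<eta> + axis i 1)" by simp
    also have "\<dots> = (u (\<eta> + axis i 1) * B j (\<eta> + axis i 1)) * (lam * (real (\<eta> $ i) + 1))"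
      by (simp add: balance[OF assms])
    also have "\<dots> = u (\<eta> + axis i 1 + axis j 1) * (lam * (real ((\<eta> + axis i 1) $ j) + 1))
        * (lam * (real (\<eta> $ i) + 1))"
      by (simp only: balance[OF True])
    finally show ?thesis .
  next
    case False
    then have "\<eta> + axis i 1 + axis j 1 \<notin> X" using down_closed by blast
    then show ?thesis using False weight_boundary[OF assms False] u_out by simp
  qed
  have "u \<eta> * (B i \<eta> * B j (\<eta> + axis i 1)) = u \<eta> * (B j \<eta> * B i (\<eta> + axis j 1))"
    using two[of i j] two[of j i] by (cases "i = j") (auto simp: axis_def add_ac)
  then show ?thesis using u_pos[OF assms] by simp
qed

text \<open>Jensen's inequality over the coupled moves of one pair of neighbours. The error of order
  e^2 comes from the quadratic term of the contraction clause and vanishes for \<alpha> = 1.\<close>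

lemma step_coupling:
  assumes P: "coupling_cost \<alpha> P" and f: "\<And>\<eta>. 0 < f \<eta>" and "\<eta> + axis i 1 \<in> X"
    and e: "0 < e" "4 * e * R \<le> 1" and R: "\<And>\<eta>. \<eta> \<in> X \<Longrightarrow> (\<Sum>j\<in>UNIV. B j \<eta> + lam * real (\<eta> $ j)) \<le> R"
    and lamR: "lam \<le> R"
  defines "\<eta>' \<equiv> \<eta> + axis i 1"
  defines "p \<equiv> \<lambda>i \<xi>. P (f \<xi>) (f (\<xi> + axis i 1))"
  shows "P (step e f \<eta>) (step e f \<eta>') \<le> p i \<eta>
     + e * (\<Sum>j\<in>UNIV. B j \<eta>' * (p i (\<eta> + axis j 1) - p i \<eta>))
     + e * (\<Sum>j\<in>UNIV. lam * real (\<eta> $ j) * (p i (\<eta> - axis j 1) - p i \<eta>))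
     + e * (\<Sum>j\<in>UNIV - {i}. (B j \<eta> - B j \<eta>') * (p j \<eta> - p i \<eta>))
     - e * \<alpha> * k * p i \<eta> + 8 * (\<alpha> - 1) * R\<^sup>2 * e\<^sup>2 * p i \<eta>"
proof -
  have X: "\<eta> \<in> X" "\<eta>' \<in> X" using assms(3) down_closed by (auto simp: \<eta>'_def)
  \<comment> \<open>The two merging rates: \<open>s1\<close> is the surplus birth of \<eta> in
    direction \<open>i\<close>, and \<open>s2\<close> is what the surplus births in other directions
    leave of the additional death of the upper particle. \<open>gap\<close> makes \<open>s2\<close>
    nonnegative.\<close>
  define s1 where "s1 = B i \<eta> - B i \<eta>'"
  define s2 where "s2 = lam - (\<Sum>j\<in>UNIV - {i}. B j \<eta> - B j \<eta>')"
  have Bm: "B j \<eta>' \<le> B j \<eta>" for j using B_mono[OF assms(3)] by (simp add: \<eta>'_def)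
  have R': "(\<Sum>j\<in>UNIV. B j \<eta>) + (\<Sum>j\<in>UNIV. lam * real (\<eta> $ j)) \<le> R"
    using R[OF X(1)] by (simp add: sum.distrib)
  have d_nonneg: "0 \<le> (\<Sum>j\<in>UNIV. lam * real (\<eta> $ j))" using lam_pos by (simp add: sum_nonneg)
  have "B i \<eta> \<le> (\<Sum>j\<in>UNIV. B j \<eta>)" by (rule member_le_sum) (auto simp: B_nonneg)
  then have s1: "0 \<le> s1" "s1 \<le> R" using Bm[of i] B_nonneg[of i \<eta>'] R' d_nonneg by (auto simp: s1_def)
  have s2: "0 \<le> s2" "s2 \<le> R"
    using gap[OF assms(3)] lamR sum_nonneg[of "UNIV - {i}" "\<lambda>j. B j \<eta> - B j \<eta>'"] Bm
    by (auto simp: s2_def \<eta>'_def)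
  have ks: "k \<le> s1 + s2" using curv[OF assms(3)] by (simp add: s1_def s2_def \<eta>'_def)
  \<comment> \<open>A move of weight 1/4 over the fraction \<open>4 * e * s1\<close> of the way
    displaces the mean as much as a full merge of probability \<open>e * s1\<close>.\<close>
  define t1 where "t1 = 4 * e * s1"
  define t2 where "t2 = 4 * e * s2"
  have "t1 \<le> 4 * e * R" "t2 \<le> 4 * e * R" using s1 s2 e by (auto simp: t1_def t2_def)
  then have "t1 \<le> 1" "t2 \<le> 1" using e by linarith+
  then have t: "t1 \<in> {0..1}" "t2 \<in> {0..1}" using e s1 s2 by (auto simp: t1_def t2_def)
  define a where "a = f \<eta>"
  define b where "b = f \<eta>'"
  have ab: "0 < a" "0 < b" using f by (auto simp: a_def b_def)
  txt \<open>The two merging moves take part with weight \<open>1/4\<close> each and only go the fraction \<open>t1\<close>, \<open>t2\<close> of the way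
    to the diagonal: this borrows mass from staying put, where the last clause of \<open>coupling_cost\<close> applies.\<close>
  define w1 where "w1 = (\<lambda>j. e * B j \<eta>')"
  define w2 where "w2 = (\<lambda>j. e * (lam * real (\<eta> $ j)))"
  \<comment> \<open>A surplus birth in direction \<open>i\<close> merges the pair, so slot
    \<open>i\<close> of the matched family is free to hold the first merging move.\<close>
  define w3 where "w3 = (\<lambda>j. if j = i then 1/4 else e * (B j \<eta> - B j \<eta>'))"
  define p1 where "p1 = (\<lambda>j. (f (\<eta> + axis j 1), f (\<eta> + axis j 1 + axis i 1)))"
  define p2 where "p2 = (\<lambda>j. (f (\<eta> - axis j 1), f (\<eta> - axis j 1 + axis i 1)))"
  define p3 where "p3 = (\<lambda>j. if j = i then (a + t1 * (b - a), b) else (f (\<eta> + axis j 1), a))"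
  define p4 where "p4 = (a, b + t2 * (a - b))"
  have split_i: "(\<Sum>j\<in>UNIV. g j) = g i + (\<Sum>j\<in>UNIV - {i}. g j)" for g :: "'d \<Rightarrow> 'c::ab_group_add"
    by (rule sum.remove) auto
  \<comment> \<open>For \<open>j \<noteq> i\<close> common and surplus births add up to the birth
    rate at \<eta>. Hence all moves other than merging weigh at most \<open>e * R\<close>, which is
    at most 1/4, and each merging move weighs 1/4.\<close>
  have w_le: "sum w1 UNIV + sum w2 UNIV + sum w3 UNIV + 1/4 \<le> 1"
  proof -
    have "sum w3 UNIV = 1/4 + e * (\<Sum>j\<in>UNIV - {i}. B j \<eta> - B j \<eta>')"
      by (subst split_i) (simp add: w3_def sum_distrib_left)
    moreover have "sum w1 UNIV = e * B i \<eta>' + e * (\<Sum>j\<in>UNIV - {i}. B j \<eta>')"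
      by (subst split_i) (simp add: w1_def sum_distrib_left)
    moreover have "sum w2 UNIV = e * (\<Sum>j\<in>UNIV. lam * real (\<eta> $ j))"
      by (simp add: w2_def sum_distrib_left)
    ultimately have "sum w1 UNIV + sum w2 UNIV + sum w3 UNIV
        = 1/4 + e * (B i \<eta>' + (\<Sum>j\<in>UNIV - {i}. B j \<eta>) + (\<Sum>j\<in>UNIV. lam * real (\<eta> $ j)))"
      by (simp add: sum_subtractf algebra_simps)
    also have "\<dots> \<le> 1/4 + e * R"
      using R' Bm[of i] e(1) by (subst (asm) split_i) auto
    finally show ?thesis using e by simp
  qed
  let ?F = "\<lambda>(a, b). P a b"
  have "?F ((a, b) + ((\<Sum>j\<in>UNIV. w1 j *\<^sub>R (p1 j - (a, b))) + (\<Sum>j\<in>UNIV. w2 j *\<^sub>R (p2 j - (a, b)))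
             + (\<Sum>j\<in>UNIV. w3 j *\<^sub>R (p3 j - (a, b))) + (1/4) *\<^sub>R (p4 - (a, b))))
         \<le> ?F (a, b) + ((\<Sum>j\<in>UNIV. w1 j * (?F (p1 j) - ?F (a, b))) + (\<Sum>j\<in>UNIV. w2 j * (?F (p2 j) - ?F (a, b)))
             + (\<Sum>j\<in>UNIV. w3 j * (?F (p3 j) - ?F (a, b))) + (1/4) * (?F p4 - ?F (a, b)))"
    (is "?F (_ + ?shift) \<le> ?rhs")
  proof (rule convex_on_jensen_three_families[of "{0<..} \<times> {0<..}"])
    show "convex_on ({0<..} \<times> {0<..}) ?F" using P by (simp add: coupling_cost_def)
    show "(a, b) \<in> {0<..} \<times> {0<..}" using ab by simp
    show "p1 j \<in> {0<..} \<times> {0<..}" "p2 j \<in> {0<..} \<times> {0<..}" for j using f by (auto simp: p1_def p2_def)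
    show "p3 j \<in> {0<..} \<times> {0<..}" for j using f ab segment_pos[OF ab t(1)] by (auto simp: p3_def)
    show "p4 \<in> {0<..} \<times> {0<..}" using ab segment_pos[OF ab(2,1) t(2)] by (auto simp: p4_def)
    show "0 \<le> w1 j" "0 \<le> w2 j" "0 \<le> w3 j" for j
      using e B_nonneg lam_pos Bm by (auto simp: w1_def w2_def w3_def)
    show "sum w1 UNIV + sum w2 UNIV + sum w3 UNIV + 1/4 \<le> 1" by (rule w_le)
  qed simp
  \<comment> \<open>The coupling has the right marginals: its barycentre is the pair of values after
    one step.\<close>
  moreover have "(a, b) + ?shift = (step e f \<eta>, step e f \<eta>')"
  proof (rule prod_eqI)
    have 3: "(\<Sum>j\<in>UNIV. w3 j * (fst (p3 j) - a))
       = e * s1 * (b - a) + (\<Sum>j\<in>UNIV - {i}. e * (B j \<eta> - B j \<eta>') * (f (\<eta> + axis j 1) - a))"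
      by (subst split_i) (simp add: w3_def p3_def t1_def)
    have "(\<Sum>j\<in>UNIV. w3 j * (fst (p3 j) - a)) = (\<Sum>j\<in>UNIV. e * (B j \<eta> - B j \<eta>') * (f (\<eta> + axis j 1) - a))"
      unfolding 3 split_i[of "\<lambda>j. e * (B j \<eta> - B j \<eta>') * (f (\<eta> + axis j 1) - a)"]
      by (simp add: s1_def b_def \<eta>'_def)
    then have "a + ((\<Sum>j\<in>UNIV. w1 j * (fst (p1 j) - a)) + (\<Sum>j\<in>UNIV. w2 j * (fst (p2 j) - a))
             + (\<Sum>j\<in>UNIV. w3 j * (fst (p3 j) - a)) + (1/4) * (fst p4 - a)) = step e f \<eta>"
      using X by (simp add: step_def gen_def w1_def p1_def w2_def p2_def p4_def a_def[symmetric]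
          sum_distrib_left sum.distrib[symmetric] algebra_simps)
    then show "fst ((a, b) + ?shift) = fst (step e f \<eta>, step e f \<eta>')"
      by (simp add: fst_sum)
  next
    have "(\<Sum>j\<in>UNIV. w3 j * (snd (p3 j) - b)) = (\<Sum>j\<in>UNIV - {i}. e * (B j \<eta> - B j \<eta>') * (a - b))"
      by (subst split_i) (simp add: w3_def p3_def)
    also have "\<dots> = e * (lam - s2) * (a - b)"
      by (simp only: sum_distrib_left[symmetric] sum_distrib_right[symmetric] s2_def) simp
    finally have "(\<Sum>j\<in>UNIV. w3 j * (snd (p3 j) - b)) = e * (lam - s2) * (a - b)" .
    then have 3: "(\<Sum>j\<in>UNIV. w3 j * (snd (p3 j) - b)) + (1/4) * (snd p4 - b) = e * lam * (a - b)"
      by (simp add: p4_def t2_def algebra_simps)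
    \<comment> \<open>The upper configuration has one additional particle, at \<open>i\<close>,
      whose death leads to \<eta>. The case \<open>\<eta> $ j = 0\<close> is separate since
      truncated subtraction does not commute with adding \<open>axis i 1\<close> when
      \<open>j = i\<close>.\<close>
    have death: "real (\<eta>' $ j) * (f (\<eta>' - axis j 1) - b) =
        real (\<eta> $ j) * (f (\<eta> - axis j 1 + axis i 1) - b) + (if j = i then a - b else 0)" for j
    proof (cases "\<eta> $ j = 0")
      case True
      then show ?thesis by (auto simp: \<eta>'_def axis_def a_def b_def vec_eq_iff)
    next
      case False
      then have "\<eta>' - axis j 1 = \<eta> - axis j 1 + axis i 1"
        by (auto simp: \<eta>'_def axis_def vec_eq_iff)
      moreover have "\<eta> - axis i 1 + axis i 1 = \<eta>" if "j = i"
        using that False by (auto simp: axis_def vec_eq_iff)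
      ultimately show ?thesis by (auto simp: \<eta>'_def axis_def a_def algebra_simps)
    qed
    have gen': "gen f \<eta>' = (\<Sum>j\<in>UNIV. B j \<eta>' * (f (\<eta> + axis j 1 + axis i 1) - b))
       + ((\<Sum>j\<in>UNIV. lam * real (\<eta> $ j) * (f (\<eta> - axis j 1 + axis i 1) - b)) + lam * (a - b))"
    proof -
      have "(\<Sum>j\<in>UNIV. lam * real (\<eta>' $ j) * (f (\<eta>' - axis j 1) - b))
          = (\<Sum>j\<in>UNIV. lam * real (\<eta> $ j) * (f (\<eta> - axis j 1 + axis i 1) - b)) + lam * (a - b)"
        by (simp add: mult.assoc death distrib_left sum.distrib if_distrib[of "(*) lam"]
            cong: if_cong del: One_nat_def)
      then show ?thesis
        unfolding gen_def b_def[symmetric] by (simp add: \<eta>'_def add_ac)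
    qed
    have "b + ((\<Sum>j\<in>UNIV. w1 j * (snd (p1 j) - b)) + (\<Sum>j\<in>UNIV. w2 j * (snd (p2 j) - b))
             + ((\<Sum>j\<in>UNIV. w3 j * (snd (p3 j) - b)) + (1/4) * (snd p4 - b))) = step e f \<eta>'"
      unfolding 3 using X
      by (simp add: step_def gen' w1_def p1_def w2_def p2_def b_def[symmetric]
          sum_distrib_left distrib_left mult.assoc)
    then show "snd ((a, b) + ?shift) = snd (step e f \<eta>, step e f \<eta>')"
      by (simp add: snd_sum add.assoc)
  qed
  moreover have "?rhs \<le> p i \<eta>
     + e * (\<Sum>j\<in>UNIV. B j \<eta>' * (p i (\<eta> + axis j 1) - p i \<eta>))
     + e * (\<Sum>j\<in>UNIV. lam * real (\<eta> $ j) * (p i (\<eta> - axis j 1) - p i \<eta>))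
     + e * (\<Sum>j\<in>UNIV - {i}. (B j \<eta> - B j \<eta>') * (p j \<eta> - p i \<eta>))
     - e * \<alpha> * k * p i \<eta> + 8 * (\<alpha> - 1) * R\<^sup>2 * e\<^sup>2 * p i \<eta>"
  proof -
    define c where "c = P a b"
    have c: "c = p i \<eta>" "0 \<le> c"
      using coupling_cost_nonneg[OF P ab] by (auto simp: c_def p_def a_def b_def \<eta>'_def)
    have sym: "P x y = P y x" if "0 < x" "0 < y" for x y using P that by (auto simp: coupling_cost_def)
    have \<alpha>: "1 \<le> \<alpha>" using P by (simp add: coupling_cost_def)
    have contr: "P (x + s * (y - x)) y \<le> (1 - \<alpha> * s + (\<alpha> - 1) * s\<^sup>2) * P x y"
      if "0 < x" "0 < y" "s \<in> {0..1}" for x y s using P that by (auto simp: coupling_cost_def)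
    have m1: "P (a + t1 * (b - a)) b - c \<le> (- \<alpha> * t1 + (\<alpha> - 1) * t1\<^sup>2) * c"
      using contr[OF ab t(1)] by (simp add: c_def algebra_simps)
    have m2: "P a (b + t2 * (a - b)) - c \<le> (- \<alpha> * t2 + (\<alpha> - 1) * t2\<^sup>2) * c"
      using contr[OF ab(2,1) t(2)] sym[OF ab] sym[OF ab(1) segment_pos[OF ab(2,1) t(2)]]
      by (simp add: c_def algebra_simps)
    have "(\<Sum>j\<in>UNIV. w3 j * (?F (p3 j) - c))
        = 1/4 * (P (a + t1 * (b - a)) b - c)
          + (\<Sum>j\<in>UNIV - {i}. e * (B j \<eta> - B j \<eta>') * (P (f (\<eta> + axis j 1)) a - c))"
      by (subst split_i) (simp add: w3_def p3_def)
    \<comment> \<open>A matched move ends in the pair (\<eta> + e_j, \<eta>), which by symmetry of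
      \<open>P\<close> costs as much as the edge in direction \<open>j\<close> at \<eta>.\<close>
    also have "(\<Sum>j\<in>UNIV - {i}. e * (B j \<eta> - B j \<eta>') * (P (f (\<eta> + axis j 1)) a - c))
        = e * (\<Sum>j\<in>UNIV - {i}. (B j \<eta> - B j \<eta>') * (p j \<eta> - c))"
      using f by (auto simp: sum_distrib_left p_def a_def mult.assoc intro!: sum.cong sym)
    finally have 3: "(\<Sum>j\<in>UNIV. w3 j * (?F (p3 j) - c)) = 1/4 * (P (a + t1 * (b - a)) b - c)
        + e * (\<Sum>j\<in>UNIV - {i}. (B j \<eta> - B j \<eta>') * (p j \<eta> - c))" .
    have 1: "(\<Sum>j\<in>UNIV. w1 j * (?F (p1 j) - c)) = e * (\<Sum>j\<in>UNIV. B j \<eta>' * (p i (\<eta> + axis j 1) - c))"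
      by (simp add: w1_def p1_def p_def sum_distrib_left mult.assoc)
    have 2: "(\<Sum>j\<in>UNIV. w2 j * (?F (p2 j) - c)) = e * (\<Sum>j\<in>UNIV. lam * real (\<eta> $ j) * (p i (\<eta> - axis j 1) - c))"
      by (simp add: w2_def p2_def p_def sum_distrib_left mult.assoc)
    have "s1\<^sup>2 \<le> R\<^sup>2" "s2\<^sup>2 \<le> R\<^sup>2" using s1 s2 by (auto intro: power_mono)
    \<comment> \<open>A quarter of the square of \<open>4 * e * s1\<close> is 4 (e s1)^2; two such
      terms with merging rates at most \<open>R\<close> produce the constant 8.\<close>
    then have sq: "(\<alpha> - 1) * (s1\<^sup>2 + s2\<^sup>2) \<le> (\<alpha> - 1) * (2 * R\<^sup>2)" using \<alpha> by (intro mult_left_mono) auto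
    have "1/4 * (P (a + t1 * (b - a)) b - c) + 1/4 * (P a (b + t2 * (a - b)) - c)
        \<le> 1/4 * ((- \<alpha> * t1 + (\<alpha> - 1) * t1\<^sup>2) * c) + 1/4 * ((- \<alpha> * t2 + (\<alpha> - 1) * t2\<^sup>2) * c)"
      by (intro add_mono mult_left_mono m1 m2) auto
    also have "\<dots> = (- (e * \<alpha> * (s1 + s2)) + 4 * e\<^sup>2 * ((\<alpha> - 1) * (s1\<^sup>2 + s2\<^sup>2))) * c"
      by (simp add: t1_def t2_def power2_eq_square field_simps)
    also have "\<dots> \<le> (- (e * \<alpha> * k) + 4 * e\<^sup>2 * ((\<alpha> - 1) * (2 * R\<^sup>2))) * c"
      using mult_left_mono[OF sq, of "4 * e\<^sup>2"] mult_left_mono[OF ks, of "e * \<alpha>"] e \<alpha> c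
      by (intro mult_right_mono add_mono) auto
    also have "\<dots> = - e * \<alpha> * k * c + 8 * (\<alpha> - 1) * R\<^sup>2 * e\<^sup>2 * c" by (simp add: algebra_simps)
    finally have merge: "1/4 * (P (a + t1 * (b - a)) b - c) + 1/4 * (P a (b + t2 * (a - b)) - c)
        \<le> - e * \<alpha> * k * c + 8 * (\<alpha> - 1) * R\<^sup>2 * e\<^sup>2 * c" .
    have base: "?F (a, b) = c" "?F p4 = P a (b + t2 * (a - b))" by (simp_all add: c_def p4_def)
    show ?thesis
      unfolding base 1 2 3 c(1)[symmetric] using merge by linarith
  qed
  ultimately show ?thesis by simp
qed

section \<open>Energy decay, entropy dissipation and convergence of the iterates\<close>

lemma B_pos: "\<eta> + axis i 1 \<in> X \<Longrightarrow> 0 < B i \<eta>"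
  using balance[of \<eta> i] u_pos[of \<eta>] u_pos[of "\<eta> + axis i 1"] down_closed[of \<eta> i] lam_pos B_nonneg[of i \<eta>]
  by (cases "B i \<eta> = 0") auto

text \<open>After summation against the reversible weights only the merging gain survives: the
  matched moves \<open>T3\<close> cancel among themselves, and the common births \<open>T1\<close>
  cancel the common deaths \<open>T2\<close>.\<close>

lemma energy_step:
  assumes P: "coupling_cost \<alpha> P" and f: "\<And>\<eta>. 0 < f \<eta>"
    and e: "0 < e" "4 * e * R \<le> 1" and R: "\<And>\<eta>. \<eta> \<in> X \<Longrightarrow> (\<Sum>j\<in>UNIV. B j \<eta> + lam * real (\<eta> $ j)) \<le> R"
    and lamR: "lam \<le> R"
  shows "energy P (step e f) \<le> (1 - e * \<alpha> * k + 8 * (\<alpha> - 1) * R\<^sup>2 * e\<^sup>2) * energy P f"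
proof -
  define p where "p = (\<lambda>i \<xi>. P (f \<xi>) (f (\<xi> + axis i 1)))"
  define T1 where "T1 = (\<lambda>i \<eta>. \<Sum>j\<in>UNIV. B j (\<eta> + axis i 1) * (p i (\<eta> + axis j 1) - p i \<eta>))"
  define T2 where "T2 = (\<lambda>i \<eta>. \<Sum>j\<in>UNIV. lam * real (\<eta> $ j) * (p i (\<eta> - axis j 1) - p i \<eta>))"
  define T3 where "T3 = (\<lambda>i \<eta>. \<Sum>j\<in>UNIV - {i}. (B j \<eta> - B j (\<eta> + axis i 1)) * (p j \<eta> - p i \<eta>))"
  define c where "c = 1 - e * \<alpha> * k + 8 * (\<alpha> - 1) * R\<^sup>2 * e\<^sup>2"
  have "energy P (step e f) \<le> (\<Sum>\<eta>\<in>X. \<Sum>i\<in>UNIV. u \<eta> * B i \<eta> *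
      (c * p i \<eta> + e * T1 i \<eta> + e * T2 i \<eta> + e * T3 i \<eta>))"
    unfolding energy_def
  proof (intro sum_mono)
    fix \<eta> i assume \<eta>: "\<eta> \<in> X"
    show "u \<eta> * B i \<eta> * P (step e f \<eta>) (step e f (\<eta> + axis i 1))
        \<le> u \<eta> * B i \<eta> * (c * p i \<eta> + e * T1 i \<eta> + e * T2 i \<eta> + e * T3 i \<eta>)"
    proof (cases "\<eta> + axis i 1 \<in> X")
      case True
      have "P (step e f \<eta>) (step e f (\<eta> + axis i 1)) \<le> c * p i \<eta> + e * T1 i \<eta> + e * T2 i \<eta> + e * T3 i \<eta>"
        using step_coupling[OF P f True e R lamR]
        by (simp add: p_def T1_def T2_def T3_def c_def algebra_simps)
      then show ?thesis using u_pos[OF \<eta>] B_nonneg[of i \<eta>] by (intro mult_left_mono) auto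
    qed (simp add: weight_boundary[OF \<eta>])
  qed
  also have "\<dots> = c * energy P f
      + e * ((\<Sum>\<eta>\<in>X. \<Sum>i\<in>UNIV. u \<eta> * B i \<eta> * T1 i \<eta>) + (\<Sum>\<eta>\<in>X. \<Sum>i\<in>UNIV. u \<eta> * B i \<eta> * T2 i \<eta>))
      + e * (\<Sum>\<eta>\<in>X. \<Sum>i\<in>UNIV. u \<eta> * B i \<eta> * T3 i \<eta>)"
    by (simp add: energy_def p_def sum.distrib distrib_left sum_distrib_left mult_ac)
  also have "(\<Sum>\<eta>\<in>X. \<Sum>i\<in>UNIV. u \<eta> * B i \<eta> * T3 i \<eta>) = 0"
  proof (rule sum.neutral, safe)
    fix \<eta> assume \<eta>: "\<eta> \<in> X"
    \<comment> \<open>The weighted rate at which an edge in direction \<open>i\<close> is turned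
      into one in direction \<open>j\<close>. By the cycle condition it is symmetric, so gains and
      losses balance at each \<eta>.\<close>
    define S where "S i j = u \<eta> * B i \<eta> * (B j \<eta> - B j (\<eta> + axis i 1))" for i j
    have sym: "S i j = S j i" for i j
      using B_commute[OF \<eta>, of i j] by (simp add: S_def algebra_simps)
    have "u \<eta> * B i \<eta> * T3 i \<eta> = (\<Sum>j\<in>UNIV. S i j * (p j \<eta> - p i \<eta>))" for i
      by (simp add: T3_def sum.remove[of UNIV i] S_def sum_distrib_left mult.assoc)
    then have "(\<Sum>i\<in>UNIV. u \<eta> * B i \<eta> * T3 i \<eta>)
        = (\<Sum>i\<in>UNIV. \<Sum>j\<in>UNIV. S i j * p j \<eta>) - (\<Sum>i\<in>UNIV. \<Sum>j\<in>UNIV. S i j * p i \<eta>)"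
      by (simp add: right_diff_distrib sum_subtractf)
    also have "(\<Sum>i\<in>UNIV. \<Sum>j\<in>UNIV. S i j * p j \<eta>) = (\<Sum>i\<in>UNIV. \<Sum>j\<in>UNIV. S i j * p i \<eta>)"
      by (subst sum.swap) (simp add: sym)
    finally show "(\<Sum>i\<in>UNIV. u \<eta> * B i \<eta> * T3 i \<eta>) = 0" by simp
  qed
  also have "(\<Sum>\<eta>\<in>X. \<Sum>i\<in>UNIV. u \<eta> * B i \<eta> * T2 i \<eta>) = - (\<Sum>\<eta>\<in>X. \<Sum>i\<in>UNIV. u \<eta> * B i \<eta> * T1 i \<eta>)"
  proof -
    have "(\<Sum>\<eta>\<in>X. \<Sum>i\<in>UNIV. u \<eta> * B i \<eta> * T2 i \<eta>)
        = (\<Sum>i\<in>UNIV. \<Sum>j\<in>UNIV. \<Sum>\<eta>\<in>X. u \<eta> * (lam * real (\<eta> $ j)) * (B i \<eta> * (p i (\<eta> - axis j 1) - p i \<eta>)))"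
      by (simp add: T2_def sum_distrib_left sum.swap[of _ UNIV X] mult_ac)
    \<comment> \<open>\<open>exchange\<close> rewrites the common deaths as births in direction
      \<open>j\<close>; the cycle condition then lets the birth in direction \<open>i\<close> come
      first, which gives the common births with the opposite sign.\<close>
    also have "\<dots> = (\<Sum>i\<in>UNIV. \<Sum>j\<in>UNIV. \<Sum>\<eta>\<in>X. u \<eta> * B j \<eta> * (B i (\<eta> + axis j 1) * (p i \<eta> - p i (\<eta> + axis j 1))))"
      by (intro sum.cong refl exchange[where h = "\<lambda>\<xi> \<eta>. B _ \<eta> * (p _ \<xi> - p _ \<eta>)"])
    also have "\<dots> = (\<Sum>i\<in>UNIV. \<Sum>j\<in>UNIV. \<Sum>\<eta>\<in>X. - (u \<eta> * B i \<eta> * (B j (\<eta> + axis i 1) * (p i (\<eta> + axis j 1) - p i \<eta>))))"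
    proof (intro sum.cong refl)
      fix i j \<eta> assume "\<eta> \<in> X"
      from B_commute[OF this, of i j]
      have "u \<eta> * (p i (\<eta> + axis j 1) - p i \<eta>) * (B i \<eta> * B j (\<eta> + axis i 1))
         = u \<eta> * (p i (\<eta> + axis j 1) - p i \<eta>) * (B j \<eta> * B i (\<eta> + axis j 1))" by simp
      then show "u \<eta> * B j \<eta> * (B i (\<eta> + axis j 1) * (p i \<eta> - p i (\<eta> + axis j 1)))
         = - (u \<eta> * B i \<eta> * (B j (\<eta> + axis i 1) * (p i (\<eta> + axis j 1) - p i \<eta>)))"
        by (simp add: algebra_simps)
    qed
    also have "\<dots> = - (\<Sum>\<eta>\<in>X. \<Sum>i\<in>UNIV. u \<eta> * B i \<eta> * T1 i \<eta>)"
      by (simp add: T1_def sum_distrib_left sum.swap[of _ UNIV X] sum_negf)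
    finally show ?thesis .
  qed
  finally show ?thesis by (simp add: c_def)
qed

text \<open>The matrix 1 + e L has nonnegative off-diagonal entries, and its diagonal is positive
  because e times the exit rate is below 1.\<close>

lemma step_pos:
  assumes f: "\<And>\<eta>. 0 < f \<eta>" and e: "0 < e" "e * R < 1"
    and R: "\<And>\<eta>. \<eta> \<in> X \<Longrightarrow> (\<Sum>j\<in>UNIV. B j \<eta> + lam * real (\<eta> $ j)) \<le> R"
  shows "0 < step e f \<eta>"
proof (cases "\<eta> \<in> X")
  case True
  define r where "r = (\<Sum>j\<in>UNIV. B j \<eta> + lam * real (\<eta> $ j))"
  have "gen f \<eta> = (\<Sum>j\<in>UNIV. B j \<eta> * f (\<eta> + axis j 1)) + (\<Sum>j\<in>UNIV. lam * real (\<eta> $ j) * f (\<eta> - axis j 1)) - r * f \<eta>"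
    by (simp add: gen_def r_def right_diff_distrib sum_subtractf sum_distrib_right sum.distrib distrib_right)
  moreover have "0 \<le> (\<Sum>j\<in>UNIV. B j \<eta> * f (\<eta> + axis j 1))" "0 \<le> (\<Sum>j\<in>UNIV. lam * real (\<eta> $ j) * f (\<eta> - axis j 1))"
    using f lam_pos B_nonneg by (auto intro!: sum_nonneg mult_nonneg_nonneg simp: less_imp_le)
  ultimately have "- (r * f \<eta>) \<le> gen f \<eta>" by simp
  then have "e * (- (r * f \<eta>)) \<le> e * gen f \<eta>" using e by (intro mult_left_mono) auto
  moreover have "e * r < 1"
    using e(2) mult_left_mono[OF R[OF True], of e] e(1) unfolding r_def by linarith
  then have "0 < (1 - e * r) * f \<eta>" using f by simp
  ultimately show ?thesis using True by (simp add: step_def algebra_simps)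
qed (simp add: step_def f)

lemma sum_step: "(\<Sum>\<eta>\<in>X. u \<eta> * step e f \<eta>) = (\<Sum>\<eta>\<in>X. u \<eta> * f \<eta>)"
proof -
  have "(\<Sum>\<eta>\<in>X. u \<eta> * step e f \<eta>) = (\<Sum>\<eta>\<in>X. u \<eta> * f \<eta>) + e * (\<Sum>\<eta>\<in>X. u \<eta> * (1 * gen f \<eta>))"
    by (simp add: step_def distrib_left sum.distrib sum_distrib_left mult_ac)
  then show ?thesis by (simp only: sum_gen_by_parts) simp
qed

text \<open>The new value of \<phi> lies above its linearisation at \<open>f \<eta>\<close>, so the
  true entropy drop is at most the first-order one, which summation by parts turns into the
  energy.\<close>

lemma entropy_step:
  assumes tangent: "\<And>a x. 0 < a \<Longrightarrow> 0 < x \<Longrightarrow> \<phi> a + \<phi>' a * (x - a) \<le> \<phi> x"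
    and f: "\<And>\<eta>. 0 < f \<eta>" "\<And>\<eta>. 0 < step e f \<eta>"
  shows "(\<Sum>\<eta>\<in>X. u \<eta> * \<phi> (f \<eta>)) - (\<Sum>\<eta>\<in>X. u \<eta> * \<phi> (step e f \<eta>))
     \<le> e * energy (\<lambda>a b. (\<phi>' b - \<phi>' a) * (b - a)) f"
proof -
  have "(\<Sum>\<eta>\<in>X. u \<eta> * \<phi> (f \<eta>)) + e * (\<Sum>\<eta>\<in>X. u \<eta> * (\<phi>' (f \<eta>) * gen f \<eta>))
      = (\<Sum>\<eta>\<in>X. u \<eta> * (\<phi> (f \<eta>) + \<phi>' (f \<eta>) * (step e f \<eta> - f \<eta>)))"
    by (simp add: step_def distrib_left sum.distrib sum_distrib_left mult_ac)
  also have "\<dots> \<le> (\<Sum>\<eta>\<in>X. u \<eta> * \<phi> (step e f \<eta>))"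
    using tangent f u_pos by (intro sum_mono mult_left_mono) (auto intro: less_imp_le)
  finally show ?thesis
    unfolding sum_gen_by_parts energy_def by simp
qed

text \<open>The quadratic energy has rate 1, hence no error term, and decays geometrically. So the
  differences across edges vanish in the limit, all values approach the one at the origin, and the
  conserved weighted sum identifies the limit.\<close>

lemma step_iterates_converge:
  assumes f: "\<And>\<eta>. 0 < f \<eta>" and e: "0 < e" "4 * e * R \<le> 1" "e * k \<le> 1" and "0 < k"
    and R: "\<And>\<eta>. \<eta> \<in> X \<Longrightarrow> (\<Sum>j\<in>UNIV. B j \<eta> + lam * real (\<eta> $ j)) \<le> R" and lamR: "lam \<le> R"
    and "\<eta> \<in> X"
  shows "(\<lambda>n. (step e ^^ n) f \<eta>) \<longlonglongrightarrow> (\<Sum>\<eta>\<in>X. u \<eta> * f \<eta>) / (\<Sum>\<eta>\<in>X. u \<eta>)"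
proof -
  define g where "g = (\<lambda>n. (step e ^^ n) f)"
  have g_Suc: "g (Suc n) = step e (g n)" and g0: "g 0 = f" for n by (simp_all add: g_def)
  have "0 < e * lam" using e lam_pos by simp
  then have eR: "e * R < 1" using e by simp
  have g_pos: "0 < g n \<eta>" for n \<eta>
    by (induction n arbitrary: \<eta>) (auto simp: g0 g_Suc f intro!: step_pos[OF _ e(1) eR R])
  let ?Q = "\<lambda>a b :: real. (b - a)\<^sup>2"
  have Q: "energy ?Q (g n) \<le> (1 - e * k) ^ n * energy ?Q f" for n
  proof (induction n)
    case (Suc n)
    have "energy ?Q (g (Suc n)) \<le> (1 - e * k) * energy ?Q (g n)"
      using energy_step[OF coupling_cost_square g_pos e(1,2) R lamR] by (simp add: g_Suc)
    also have "\<dots> \<le> (1 - e * k) * ((1 - e * k) ^ n * energy ?Q f)"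
      using Suc e by (intro mult_left_mono) auto
    finally show ?case by simp
  qed (simp add: g0)
  have lim0: "(\<lambda>n. (1 - e * k) ^ n * energy ?Q f) \<longlonglongrightarrow> 0"
    using e \<open>0 < k\<close> by (intro tendsto_mult_left_zero LIMSEQ_power_zero) auto
  have edge: "(\<lambda>n. g n (\<eta> + axis i 1) - g n \<eta>) \<longlonglongrightarrow> 0" if \<eta>: "\<eta> + axis i 1 \<in> X" for \<eta> i
  proof -
    have X: "\<eta> \<in> X" using down_closed[OF \<eta>] .
    define w where "w = u \<eta> * B i \<eta>"
    have w: "0 < w" using u_pos[OF X] B_pos[OF \<eta>] by (simp add: w_def)
    have "w * (g n (\<eta> + axis i 1) - g n \<eta>)\<^sup>2 \<le> energy ?Q (g n)" for n
    proof -
      have nn: "0 \<le> u \<xi> * B j \<xi> * (g n (\<xi> + axis j 1) - g n \<xi>)\<^sup>2" if "\<xi> \<in> X" for \<xi> j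
        using u_pos[OF that] B_nonneg[of j \<xi>] by simp
      have "w * (g n (\<eta> + axis i 1) - g n \<eta>)\<^sup>2 \<le> (\<Sum>i\<in>UNIV. u \<eta> * B i \<eta> * (g n (\<eta> + axis i 1) - g n \<eta>)\<^sup>2)"
        unfolding w_def using nn[OF X] by (intro member_le_sum) auto
      also have "\<dots> \<le> energy ?Q (g n)"
        unfolding energy_def using nn X fin
        by (intro member_le_sum[where f = "\<lambda>\<eta>. \<Sum>i\<in>UNIV. u \<eta> * B i \<eta> * (g n (\<eta> + axis i 1) - g n \<eta>)\<^sup>2"])
          (auto intro: sum_nonneg)
      finally show ?thesis .
    qed
    then have "w * (g n (\<eta> + axis i 1) - g n \<eta>)\<^sup>2 \<le> (1 - e * k) ^ n * energy ?Q f" for n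
      using Q order_trans by blast
    then have "(\<lambda>n. w * (g n (\<eta> + axis i 1) - g n \<eta>)\<^sup>2) \<longlonglongrightarrow> 0"
      using w by (intro tendsto_sandwich[OF _ _ tendsto_const lim0]) auto
    then have "(\<lambda>n. inverse w * (w * (g n (\<eta> + axis i 1) - g n \<eta>)\<^sup>2)) \<longlonglongrightarrow> inverse w * 0"
      by (intro tendsto_mult tendsto_const)
    then have "(\<lambda>n. (g n (\<eta> + axis i 1) - g n \<eta>)\<^sup>2) \<longlonglongrightarrow> 0" using w by (simp add: field_simps)
    from tendsto_real_sqrt[OF this] show ?thesis by (simp add: tendsto_rabs_zero_iff)
  qed
  have to_zero: "(\<lambda>n. g n \<eta> - g n 0) \<longlonglongrightarrow> 0" if "\<eta> \<in> X" for \<eta>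
    using that
  proof (induction \<eta> rule: nat_vec_induct)
    case (up \<eta> i)
    from tendsto_add[OF edge[OF up(2)] up(1)[OF down_closed[OF up(2)]]] show ?case by simp
  qed simp
  define U where "U = (\<Sum>\<eta>\<in>X. u \<eta>)"
  define M where "M = (\<Sum>\<eta>\<in>X. u \<eta> * f \<eta>)"
  have U: "0 < U" unfolding U_def using zero_in by (intro sum_pos fin u_pos) auto
  have M: "(\<Sum>\<eta>\<in>X. u \<eta> * g n \<eta>) = M" for n
    by (induction n) (simp_all add: g0 g_Suc M_def sum_step)
  have "(\<lambda>n. \<Sum>\<eta>\<in>X. u \<eta> * (g n \<eta> - g n 0)) \<longlonglongrightarrow> (\<Sum>\<eta>\<in>X. u \<eta> * 0)"
    by (intro tendsto_sum tendsto_mult tendsto_const to_zero)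
  moreover have "(\<Sum>\<eta>\<in>X. u \<eta> * (g n \<eta> - g n 0)) = M - U * g n 0" for n
    by (simp add: right_diff_distrib sum_subtractf M U_def sum_distrib_right)
  ultimately have "(\<lambda>n. M - U * g n 0) \<longlonglongrightarrow> 0" by simp
  then have "(\<lambda>n. (M - (M - U * g n 0)) / U + (g n \<eta> - g n 0)) \<longlonglongrightarrow> (M - 0) / U + 0"
    using U by (intro tendsto_intros to_zero \<open>\<eta> \<in> X\<close>) auto
  then show ?thesis using U by (simp add: g_def M_def U_def)
qed

text \<open>A discrete Bakry-Emery argument. Each step loses at most e times the energy in entropy,
  while the energy loses at least e (\<alpha> k - c e) times itself. Telescoping over infinitely
  many steps and then letting e tend to 0 gives the claim.\<close>

lemma box_sobolev:
  assumes P: "coupling_cost \<alpha> (\<lambda>a b. (\<phi>' b - \<phi>' a) * (b - a))"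
    and tangent: "\<And>a x. 0 < a \<Longrightarrow> 0 < x \<Longrightarrow> \<phi> a + \<phi>' a * (x - a) \<le> \<phi> x"
    and cont: "\<And>a. 0 < a \<Longrightarrow> isCont \<phi> a"
    and f: "\<And>\<eta>. 0 < f \<eta>" and "0 < k"
  shows "\<alpha> * k * ((\<Sum>\<eta>\<in>X. u \<eta> * \<phi> (f \<eta>))
       - (\<Sum>\<eta>\<in>X. u \<eta>) * \<phi> ((\<Sum>\<eta>\<in>X. u \<eta> * f \<eta>) / (\<Sum>\<eta>\<in>X. u \<eta>)))
     \<le> energy (\<lambda>a b. (\<phi>' b - \<phi>' a) * (b - a)) f" (is "_ * (?E f - ?m) \<le> energy ?P f")
proof -
  have \<alpha>: "1 \<le> \<alpha>" using P by (simp add: coupling_cost_def)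
  define R where "R = lam + (\<Sum>\<eta>\<in>X. \<Sum>j\<in>UNIV. B j \<eta> + lam * real (\<eta> $ j))"
  have rate_nonneg: "0 \<le> (\<Sum>j\<in>UNIV. B j \<eta> + lam * real (\<eta> $ j))" for \<eta>
    using lam_pos B_nonneg by (intro sum_nonneg) auto
  then have R: "(\<Sum>j\<in>UNIV. B j \<eta> + lam * real (\<eta> $ j)) \<le> R" if "\<eta> \<in> X" for \<eta>
    using member_le_sum[OF that, of "\<lambda>\<eta>. \<Sum>j\<in>UNIV. B j \<eta> + lam * real (\<eta> $ j)"] fin lam_pos
    by (simp add: R_def)
  have lamR: "lam \<le> R" using rate_nonneg by (simp add: R_def sum_nonneg)
  define c where "c = 8 * (\<alpha> - 1) * R\<^sup>2"
  define U where "U = (\<Sum>\<eta>\<in>X. u \<eta>)"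
  have U: "0 < U" unfolding U_def using zero_in by (intro sum_pos fin u_pos) auto
  have mean_pos: "0 < (\<Sum>\<eta>\<in>X. u \<eta> * f \<eta>)"
    using zero_in by (intro sum_pos fin) (auto simp: u_pos f)
  have bound: "(\<alpha> * k - c * e) * (?E f - ?m) \<le> energy ?P f"
    if e: "0 < e" "4 * e * R \<le> 1" "e * k \<le> 1" "c * e \<le> \<alpha> * k" for e
  proof -
    define g where "g = (\<lambda>n. (step e ^^ n) f)"
    have g_Suc: "g (Suc n) = step e (g n)" and g0: "g 0 = f" for n by (simp_all add: g_def)
    have "0 < e * lam" using e lam_pos by simp
    then have eR: "e * R < 1" using e by simp
    have g_pos: "0 < g n \<eta>" for n \<eta>
      by (induction n arbitrary: \<eta>) (auto simp: g0 g_Suc f intro!: step_pos[OF _ e(1) eR R])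
    \<comment> \<open>The telescoped comparison of lost entropy with lost energy;
      \<open>c * e \<le> \<alpha> * k\<close> keeps the prefactor nonnegative.\<close>
    have decr: "(\<alpha> * k - c * e) * (?E f - ?E (g n)) \<le> energy ?P f - energy ?P (g n)" for n
    proof (induction n)
      case (Suc n)
      have "(\<alpha> * k - c * e) * (?E (g n) - ?E (g (Suc n))) \<le> (\<alpha> * k - c * e) * (e * energy ?P (g n))"
        using entropy_step[OF tangent g_pos, where e = e] e(4) g_pos[of "Suc n"]
        by (intro mult_left_mono) (auto simp: g_Suc)
      moreover have "energy ?P (g (Suc n)) \<le> (1 - e * \<alpha> * k + c * e\<^sup>2) * energy ?P (g n)"
        using energy_step[OF P g_pos e(1,2) R lamR] by (simp add: g_Suc c_def)
      ultimately show ?case using Suc by (simp add: algebra_simps power2_eq_square)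
    qed (simp add: g0)
    have "0 \<le> energy ?P (g n)" for n
      unfolding energy_def
      by (intro sum_nonneg mult_nonneg_nonneg[OF _ coupling_cost_nonneg[OF P g_pos g_pos]]
          mult_nonneg_nonneg[OF less_imp_le[OF u_pos] B_nonneg]) auto
    then have le: "(\<alpha> * k - c * e) * (?E f - ?E (g n)) \<le> energy ?P f" for n
      using decr[of n] by (smt (verit))
    \<comment> \<open>The iterates converge to the weighted mean, which is positive, so \<phi> is
      continuous there.\<close>
    have "(\<lambda>n. ?E (g n)) \<longlonglongrightarrow> (\<Sum>\<eta>\<in>X. u \<eta> * \<phi> ((\<Sum>\<eta>\<in>X. u \<eta> * f \<eta>) / U))"
      unfolding g_def U_def using U mean_pos
      by (intro tendsto_sum tendsto_mult tendsto_const isCont_tendsto_compose[OF cont]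
          step_iterates_converge[OF f e(1-3) \<open>0 < k\<close> R lamR]) (auto simp: U_def)
    then have "(\<lambda>n. (\<alpha> * k - c * e) * (?E f - ?E (g n))) \<longlonglongrightarrow> (\<alpha> * k - c * e) * (?E f - ?m)"
      by (intro tendsto_intros) (simp add: U_def sum_distrib_right)
    then show ?thesis by (rule LIMSEQ_le_const2) (use le in auto)
  qed
  have "((\<lambda>e. (\<alpha> * k - c * e) * (?E f - ?m)) \<longlongrightarrow> (\<alpha> * k - c * 0) * (?E f - ?m)) (at_right 0)"
    by (intro tendsto_intros)
  moreover have "\<forall>\<^sub>F e in at_right 0. (\<alpha> * k - c * e) * (?E f - ?m) \<le> energy ?P f"
  proof -
    have small: "\<forall>\<^sub>F e in at_right 0. a * e < b" if "0 < b" for a b :: real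
    proof -
      have "((\<lambda>e. a * e) \<longlongrightarrow> a * 0) (at_right 0)" by (intro tendsto_intros)
      then show ?thesis using that by (intro order_tendstoD) auto
    qed
    have "\<forall>\<^sub>F e in at_right (0::real). 0 < e" by (simp add: eventually_at_right_less)
    moreover have "\<forall>\<^sub>F e in at_right 0. (4 * R) * e < 1" by (rule small) simp
    moreover have "\<forall>\<^sub>F e in at_right 0. k * e < 1" by (rule small) simp
    moreover have "\<forall>\<^sub>F e in at_right 0. c * e < \<alpha> * k" using \<alpha> \<open>0 < k\<close> by (intro small) simp
    ultimately show ?thesis
      by eventually_elim (rule bound, auto simp: mult_ac)
  qed
  ultimately show ?thesis using tendsto_upperbound[of _ _ "at_right (0::real)"] by fastforce
qed

end

section \<open>Lattice differences and sums\<close>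

lemma has_real_derivative_along_line:
  fixes F :: "real ^ 'd::finite \<Rightarrow> real"
  assumes "(F has_derivative F') (at (x + t *\<^sub>R e))"
  shows "((\<lambda>t. F (x + t *\<^sub>R e)) has_real_derivative F' e) (at t)"
proof -
  have "((\<lambda>t. x + t *\<^sub>R e) has_derivative (\<lambda>h. h *\<^sub>R e)) (at t)"
    by (auto intro!: derivative_eq_intros)
  from has_derivative_compose[OF this assms]
  have "((\<lambda>t. F (x + t *\<^sub>R e)) has_derivative (\<lambda>h. F' (h *\<^sub>R e))) (at t)" .
  moreover have "F' (h *\<^sub>R e) = F' e * h" for h
    using has_derivative_bounded_linear[OF assms] by (simp add: linear_simps)
  ultimately show ?thesis by (simp add: has_field_derivative_def)
qed

text \<open>The derivative of \<open>V\<close> in direction \<open>j\<close> is nondecreasing along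
  direction \<open>i\<close>, so its integral over a unit segment grows when the segment is shifted
  by \<open>axis i 1\<close>.\<close>

lemma mixed_difference_nonneg:
  fixes V :: "real ^ 'd::finite \<Rightarrow> real"
  assumes "twice_cont_diff V" and mixed: "\<And>x. 0 \<le> partial i (partial j V) x"
  shows "V (x + axis j 1) - V x \<le> V (x + axis i 1 + axis j 1) - V (x + axis i 1)"
proof -
  obtain V' V'' where V': "\<And>x. (V has_derivative blinfun_apply (V' x)) (at x)"
    and V'': "\<And>x. (V' has_derivative blinfun_apply (V'' x)) (at x)"
    using assms(1) unfolding twice_cont_diff_def by blast
  define D where "D = (\<lambda>y. blinfun_apply (V' y) (axis j 1))"
  have "partial j V y = D y" for y
    using has_real_derivative_along_line[of V _ y 0 "axis j 1", OF V']
    by (simp add: partial_def D_def DERIV_imp_deriv)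
  then have partial_V: "partial j V = D" by blast
  have D': "(D has_derivative (\<lambda>h. blinfun_apply (blinfun_apply (V'' y) h) (axis j 1))) (at y)" for y
    unfolding D_def by (auto intro!: derivative_eq_intros V'')
  have D_line: "((\<lambda>s. D (y + s *\<^sub>R axis i 1)) has_real_derivative
      blinfun_apply (blinfun_apply (V'' (y + s *\<^sub>R axis i 1)) (axis i 1)) (axis j 1)) (at s)" for y s
    by (rule has_real_derivative_along_line[OF D'])
  have D'_nonneg: "0 \<le> blinfun_apply (blinfun_apply (V'' y) (axis i 1)) (axis j 1)" for y
  proof -
    have "partial i D y = blinfun_apply (blinfun_apply (V'' y) (axis i 1)) (axis j 1)"
      using D_line[of y 0] by (simp add: partial_def DERIV_imp_deriv)
    then show ?thesis using mixed[of y] by (simp add: partial_V)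
  qed
  have D_mono: "D y \<le> D (y + axis i 1)" for y
  proof -
    define g where "g = (\<lambda>s. D (y + s *\<^sub>R axis i 1))"
    have "g 0 \<le> g 1"
      by (rule DERIV_nonneg_imp_nondecreasing[where f = g]) (use D_line D'_nonneg in \<open>auto simp: g_def\<close>)
    then show ?thesis by (simp add: g_def)
  qed
  have line: "((\<lambda>t. V (y + t *\<^sub>R axis j 1)) has_real_derivative D (y + t *\<^sub>R axis j 1)) (at t)" for y t
    unfolding D_def by (rule has_real_derivative_along_line[OF V'])
  \<comment> \<open>The gap between \<open>V\<close> on two parallel segments; the claim is that it
    is no smaller at the end than at the start.\<close>
  define h where "h = (\<lambda>t. V (x + axis i 1 + t *\<^sub>R axis j 1) - V (x + t *\<^sub>R axis j 1))"
  have "h 0 \<le> h 1"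
  proof (rule DERIV_nonneg_imp_nondecreasing[where f = h])
    fix t
    have "(h has_real_derivative D (x + axis i 1 + t *\<^sub>R axis j 1) - D (x + t *\<^sub>R axis j 1)) (at t)"
      unfolding h_def by (intro DERIV_diff line)
    moreover have "D (x + t *\<^sub>R axis j 1) \<le> D (x + axis i 1 + t *\<^sub>R axis j 1)"
      using D_mono[of "x + t *\<^sub>R axis j 1"] by (simp add: add_ac)
    ultimately show "\<exists>y. (h has_real_derivative y) (at t) \<and> 0 \<le> y"
      by (metis diff_ge_0_iff_ge)
  qed simp
  then show ?thesis by (simp add: h_def)
qed

lemma birth_rate_antimono:
  fixes V :: "real ^ 'd::finite \<Rightarrow> real"
  assumes "twice_cont_diff V" "\<And>x. 0 \<le> partial i (partial j V) x"
  shows "birth_rate V j (\<eta> + axis i 1) \<le> birth_rate V j \<eta>"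
proof -
  define x where "x = (\<chi> k. real (\<eta> $ k))"
  have shift: "(\<chi> k. real ((\<xi> + axis l 1) $ k)) = (\<chi> k. real (\<xi> $ k)) + axis l 1" for \<xi> :: "nat ^ 'd" and l
    by (simp add: vec_eq_iff axis_def)
  show ?thesis
    using mixed_difference_nonneg[OF assms, of x]
    unfolding birth_rate_def nabla_def lattice_restrict_def act.simps shift x_def[symmetric] by simp
qed

section \<open>Boxes exhausting the lattice, and sums over moves\<close>

definition box :: "nat \<Rightarrow> (nat ^ 'd::finite) set" where
  "box N = {\<eta>. \<forall>i. \<eta> $ i \<le> N}"

lemma sum_box_prod:
  fixes h :: "'d::finite \<Rightarrow> nat \<Rightarrow> real"
  shows "(\<Sum>\<eta>\<in>box N. \<Prod>i\<in>UNIV. h i (\<eta> $ i)) = (\<Prod>i\<in>UNIV. \<Sum>n\<le>N. h i n)"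
proof -
  have "(\<Prod>i\<in>UNIV. \<Sum>n\<le>N. h i n) = (\<Sum>g\<in>PiE UNIV (\<lambda>_. {..N}). \<Prod>i\<in>UNIV. h i (g i))"
    by (rule prod_sum_PiE) auto
  also have "\<dots> = (\<Sum>\<eta>\<in>box N. \<Prod>i\<in>UNIV. h i (\<eta> $ i))"
    by (rule sum.reindex_bij_witness[where i = vec_nth and j = vec_lambda]) (auto simp: box_def)
  finally show ?thesis by simp
qed

lemma finite_box: "finite (box N :: (nat ^ 'd::finite) set)"
proof -
  have "box N \<subseteq> vec_lambda ` PiE (UNIV :: 'd set) (\<lambda>_. {..N})"
  proof
    fix \<eta> :: "nat ^ 'd" assume "\<eta> \<in> box N"
    then have "\<eta> = vec_lambda (vec_nth \<eta>)" "vec_nth \<eta> \<in> PiE UNIV (\<lambda>_. {..N})" by (auto simp: box_def)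
    then show "\<eta> \<in> vec_lambda ` PiE UNIV (\<lambda>_. {..N})" by blast
  qed
  then show ?thesis by (rule finite_subset) (simp add: finite_PiE)
qed

lemma finite_subset_box:
  fixes F :: "(nat ^ 'd::finite) set"
  assumes "finite F"
  obtains N where "\<And>n. N \<le> n \<Longrightarrow> F \<subseteq> box n"
proof
  define N where "N = (\<Sum>\<eta>\<in>F. \<Sum>i\<in>UNIV. \<eta> $ i)"
  fix n assume "N \<le> n"
  show "F \<subseteq> box n"
  proof
    fix \<eta> assume \<eta>: "\<eta> \<in> F"
    have "\<eta> $ i \<le> N" for i
    proof -
      have "\<eta> $ i \<le> (\<Sum>i\<in>UNIV. \<eta> $ i)" by (rule member_le_sum) auto
      also have "\<dots> \<le> N" unfolding N_def using \<eta> assms by (intro member_le_sum) auto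
      finally show ?thesis .
    qed
    then show "\<eta> \<in> box n" using \<open>N \<le> n\<close> order_trans by (auto simp: box_def)
  qed
qed

text \<open>Boxes are finite and eventually contain every finite set, so an unordered sum is the
  limit of its sums over boxes.\<close>

lemma filterlim_box: "filterlim box (finite_subsets_at_top (UNIV :: (nat ^ 'd::finite) set)) sequentially"
  unfolding filterlim_finite_subsets_at_top eventually_sequentially
  using finite_subset_box finite_box by (metis subset_UNIV)

lemma UNIV_move: "(UNIV :: 'd move set) = range Up \<union> range Down"
  by (metis UNIV_eq_I UnCI move.exhaust rangeI)

lemma finite_UNIV_move: "finite (UNIV :: 'd::finite move set)"
  by (simp add: UNIV_move)

lemma sum_move:
  fixes h :: "'d::finite move \<Rightarrow> 'a::comm_monoid_add"
  shows "(\<Sum>\<sigma>\<in>UNIV. h \<sigma>) = (\<Sum>i\<in>UNIV. h (Up i) + h (Down i))"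
  unfolding UNIV_move
  by (subst sum.union_disjoint) (auto simp: sum.reindex inj_def sum.distrib)

lemma infsum_ereal_nonneg:
  assumes "f summable_on A" "\<And>x. x \<in> A \<Longrightarrow> 0 \<le> f x"
  shows "(\<Sum>\<^sub>\<infinity>x\<in>A. ereal (f x)) = ereal (\<Sum>\<^sub>\<infinity>x\<in>A. f x)"
  using assms by (simp add: nonneg_infsum_complete infsum_nonneg_is_SUPREMUM_ereal)

section \<open>The Gibbs measure\<close>

text \<open>The sign of the mixed derivatives enters the lattice model through this monotonicity,
  for all pairs of directions including equal ones.\<close>

locale lattice_gibbs =
  fixes lam :: real and V :: "real ^ 'd::finite \<Rightarrow> real"
  assumes lam_pos: "0 < lam"
    and birth_antimono: "birth_rate V j (\<eta> + axis i 1) \<le> birth_rate V j \<eta>"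
begin

section \<open>Balance and normalisation of the Gibbs weight\<close>

lemma birth_rate_pos: "0 < birth_rate V i \<eta>"
  by (simp add: birth_rate_def)

lemma birth_rate_le: "birth_rate V j \<eta> \<le> birth_rate V j 0"
proof (induction \<eta> rule: nat_vec_induct)
  case (up \<eta> i)
  then show ?case using birth_antimono order_trans by blast
qed simp

lemma exp_shift: "exp (- lattice_restrict V (\<eta> + axis i 1)) = exp (- lattice_restrict V \<eta>) * birth_rate V i \<eta>"
  by (simp add: birth_rate_def nabla_def exp_add[symmetric] del: One_nat_def)

lemma prod_shift:
  fixes h :: "'d \<Rightarrow> nat \<Rightarrow> real"
  assumes "h i (Suc (\<eta> $ i)) = c * h i (\<eta> $ i)"
  shows "(\<Prod>j\<in>UNIV. h j ((\<eta> + axis i 1) $ j)) = c * (\<Prod>j\<in>UNIV. h j (\<eta> $ j))"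
proof -
  have "(\<Prod>j\<in>UNIV - {i}. h j ((\<eta> + axis i 1) $ j)) = (\<Prod>j\<in>UNIV - {i}. h j (\<eta> $ j))"
    by (rule prod.cong) (auto simp: axis_def)
  then show ?thesis
    using assms by (simp add: prod.remove[of UNIV i] axis_def)
qed

lemma weight_balance:
  "gibbs_weight lam V \<eta> * birth_rate V i \<eta>
     = gibbs_weight lam V (\<eta> + axis i 1) * (lam * (real (\<eta> $ i) + 1))"
proof -
  define c where "c = lam * (real (\<eta> $ i) + 1)"
  have c: "c > 0" using lam_pos by (simp add: c_def add_nonneg_pos)
  have "(\<Prod>j\<in>UNIV. (1 / lam) ^ ((\<eta> + axis i 1) $ j) / fact ((\<eta> + axis i 1) $ j))
     = 1 / c * (\<Prod>j\<in>UNIV. (1 / lam) ^ (\<eta> $ j) / fact (\<eta> $ j))"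
    by (rule prod_shift) (use lam_pos in \<open>simp add: c_def field_simps\<close>)
  then show ?thesis
    using c unfolding gibbs_weight_def exp_shift c_def[symmetric] by simp
qed

lemma weight_pos: "0 < gibbs_weight lam V \<eta>"
  using lam_pos by (simp add: gibbs_weight_def prod_pos)

text \<open>Birth rates are largest at the origin, so
  \<open>exp (- lattice_restrict V \<eta>)\<close> grows at most geometrically in each coordinate.
  With the factorials, the weight is dominated by a product of Poisson weights with parameters
  \<open>r i\<close>.\<close>

lemma weight_summable: "gibbs_weight lam V summable_on UNIV"
proof -
  define r where "r = (\<lambda>i. birth_rate V i 0 / lam)"
  have r: "0 \<le> r i" for i using lam_pos birth_rate_pos[of i 0] by (simp add: r_def)
  define C where "C = exp (- lattice_restrict V 0)"
  have C: "0 < C" by (simp add: C_def)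
  have "exp (- lattice_restrict V \<eta>) \<le> C * (\<Prod>i\<in>UNIV. birth_rate V i 0 ^ (\<eta> $ i))" for \<eta>
  proof (induction \<eta> rule: nat_vec_induct)
    case (up \<eta> i)
    have "(\<Prod>j\<in>UNIV. birth_rate V j 0 ^ ((\<eta> + axis i 1) $ j)) = birth_rate V i 0 * (\<Prod>j\<in>UNIV. birth_rate V j 0 ^ (\<eta> $ j))"
      by (rule prod_shift) simp
    moreover have "0 < (\<Prod>i\<in>UNIV. birth_rate V i 0 ^ (\<eta> $ i))"
      by (simp add: prod_pos birth_rate_pos)
    moreover from this have "exp (- lattice_restrict V \<eta>) * birth_rate V i \<eta>
        \<le> (C * (\<Prod>i\<in>UNIV. birth_rate V i 0 ^ (\<eta> $ i))) * birth_rate V i 0"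
      using up birth_rate_le birth_rate_pos C
      by (intro mult_mono) (auto intro: less_imp_le)
    ultimately show ?case unfolding exp_shift by (simp add: mult_ac del: One_nat_def)
  qed (simp add: C_def)
  then have "gibbs_weight lam V \<eta>
      \<le> C * (\<Prod>i\<in>UNIV. birth_rate V i 0 ^ (\<eta> $ i)) * (\<Prod>i\<in>UNIV. (1 / lam) ^ (\<eta> $ i) / fact (\<eta> $ i))" for \<eta>
    unfolding gibbs_weight_def using lam_pos by (intro mult_right_mono) (auto intro: prod_nonneg)
  then have le: "gibbs_weight lam V \<eta> \<le> C * (\<Prod>i\<in>UNIV. r i ^ (\<eta> $ i) / fact (\<eta> $ i))" for \<eta>
    by (simp add: r_def power_divide prod.distrib[symmetric] prod_dividef[symmetric] mult.assoc)
  have exp_bound: "(\<Sum>n\<le>N. r i ^ n / fact n) \<le> exp (r i)" for i N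
  proof -
    have "(\<lambda>n. r i ^ n / fact n) sums exp (r i)"
      using exp_converges[of "r i"] by (simp add: divide_inverse mult.commute)
    then show ?thesis
      using r[of i] sum_le_suminf[of "\<lambda>n. r i ^ n / fact n" "{..N}"] by (simp add: sums_iff)
  qed
  have "sum (gibbs_weight lam V) F \<le> C * (\<Prod>i\<in>UNIV. exp (r i))" if F: "finite F" for F
  proof -
    obtain N where "F \<subseteq> box N" using finite_subset_box[OF F] by (metis order_refl)
    then have "sum (gibbs_weight lam V) F \<le> sum (gibbs_weight lam V) (box N)"
      by (intro sum_mono2 finite_box) (auto intro: less_imp_le[OF weight_pos])
    also have "\<dots> \<le> (\<Sum>\<eta>\<in>box N. C * (\<Prod>i\<in>UNIV. r i ^ (\<eta> $ i) / fact (\<eta> $ i)))"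
      by (rule sum_mono[OF le])
    also have "\<dots> = C * (\<Prod>i\<in>UNIV. \<Sum>n\<le>N. r i ^ n / fact n)"
      by (simp add: sum_distrib_left[symmetric] sum_box_prod[of "\<lambda>i n. r i ^ n / fact n"])
    also have "\<dots> \<le> C * (\<Prod>i\<in>UNIV. exp (r i))"
      using exp_bound r C by (intro mult_left_mono prod_mono) (auto intro: sum_nonneg)
    finally show ?thesis .
  qed
  then show ?thesis
    by (intro nonneg_bdd_above_summable_on) (auto intro!: bdd_aboveI less_imp_le[OF weight_pos])
qed

lemma partition_pos: "0 < (\<Sum>\<^sub>\<infinity>\<xi>. gibbs_weight lam V \<xi>)"
proof -
  have "gibbs_weight lam V 0 \<le> (\<Sum>\<^sub>\<infinity>\<xi>. gibbs_weight lam V \<xi>)"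
    using finite_sum_le_infsum[OF weight_summable, of "{0}"] weight_pos less_imp_le by auto
  then show ?thesis using weight_pos[of 0] by linarith
qed

lemma gibbs_pos: "0 < gibbs lam V \<eta>"
  using partition_pos weight_pos by (simp add: gibbs_def)

lemma gibbs_has_sum: "(gibbs lam V has_sum 1) UNIV"
  using has_sum_cmult_right[OF has_sum_infsum[OF weight_summable], of "1 / (\<Sum>\<^sub>\<infinity>\<xi>. gibbs_weight lam V \<xi>)"]
    partition_pos
  by (simp add: gibbs_def[abs_def])

lemma gibbs_balance:
  "gibbs lam V \<eta> * birth_rate V i \<eta> = gibbs lam V (\<eta> + axis i 1) * (lam * (real (\<eta> $ i) + 1))"
  using weight_balance[of \<eta> i] by (simp add: gibbs_def)

section \<open>Reversibility, invariance and irreducibility\<close>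

lemma rates_nonneg: "0 \<le> rates lam V \<eta> \<sigma>"
  using lam_pos birth_rate_pos less_imp_le by (cases \<sigma>) auto

text \<open>A positive rate excludes the death at an empty site, the one move that its inverse does
  not undo. The last equation is \<open>gibbs_balance\<close>, read upwards for a birth and
  downwards for a death.\<close>

lemma reversal:
  assumes "0 < rates lam V \<eta> \<sigma>"
  shows "act (inv_move \<sigma>) (act \<sigma> \<eta>) = \<eta>" "inv_move (inv_move \<sigma>) = \<sigma>"
    and "0 < rates lam V (act \<sigma> \<eta>) (inv_move \<sigma>)"
    and "rates lam V (act \<sigma> \<eta>) (inv_move \<sigma>) * gibbs lam V (act \<sigma> \<eta>) = rates lam V \<eta> \<sigma> * gibbs lam V \<eta>"
proof -
  have *: "act (inv_move \<sigma>) (act \<sigma> \<eta>) = \<eta> \<and> inv_move (inv_move \<sigma>) = \<sigma> \<and>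
      0 < rates lam V (act \<sigma> \<eta>) (inv_move \<sigma>) \<and>
      rates lam V (act \<sigma> \<eta>) (inv_move \<sigma>) * gibbs lam V (act \<sigma> \<eta>) = rates lam V \<eta> \<sigma> * gibbs lam V \<eta>"
  proof (cases \<sigma>)
    case (Up i)
    have "0 < lam * (real (\<eta> $ i) + 1)" using lam_pos by (simp add: add_nonneg_pos)
    then show ?thesis
      using Up gibbs_balance[of \<eta> i] by (simp add: axis_def vec_eq_iff algebra_simps)
  next
    case (Down i)
    then have i: "0 < \<eta> $ i" using assms lam_pos by (simp add: zero_less_mult_iff)
    define \<xi> where "\<xi> = \<eta> - axis i 1"
    have \<eta>: "\<eta> = \<xi> + axis i 1" using i by (auto simp: \<xi>_def vec_eq_iff axis_def)
    have "act (Down i) \<eta> = \<xi>" using i by (simp add: \<xi>_def)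
    moreover have "real (\<eta> $ i) = real (\<xi> $ i) + 1" by (simp add: \<eta> axis_def)
    ultimately show ?thesis
      using Down gibbs_balance[of \<xi> i] birth_rate_pos[of i \<xi>] by (simp add: \<eta>[symmetric] mult_ac del: One_nat_def)
  qed
  then show "act (inv_move \<sigma>) (act \<sigma> \<eta>) = \<eta>" "inv_move (inv_move \<sigma>) = \<sigma>"
    "0 < rates lam V (act \<sigma> \<eta>) (inv_move \<sigma>)"
    "rates lam V (act \<sigma> \<eta>) (inv_move \<sigma>) * gibbs lam V (act \<sigma> \<eta>) = rates lam V \<eta> \<sigma> * gibbs lam V \<eta>"
    by auto
qed

text \<open>Reversal is an involution of the moves with positive rate and preserves the flow through
  them; all other moves contribute 0. The equivalence transfers convergence together with the
  value.\<close>

lemma has_sum_reversal: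
  fixes F :: "nat ^ 'd \<Rightarrow> 'd move \<Rightarrow> real"
  shows "((\<lambda>(\<eta>, \<sigma>). F \<eta> \<sigma> * rates lam V \<eta> \<sigma> * gibbs lam V \<eta>) has_sum s) UNIV \<longleftrightarrow>
         ((\<lambda>(\<eta>, \<sigma>). F (act \<sigma> \<eta>) (inv_move \<sigma>) * rates lam V \<eta> \<sigma> * gibbs lam V \<eta>) has_sum s) UNIV"
    (is "(?f has_sum s) UNIV \<longleftrightarrow> (?g has_sum s) UNIV")
proof -
  define S where "S = {(\<eta>, \<sigma>). 0 < rates lam V \<eta> \<sigma>}"
  define T where "T = (\<lambda>(\<eta>, \<sigma>). (act \<sigma> \<eta>, inv_move \<sigma>) :: (nat ^ 'd) \<times> 'd move)"
  have off: "?f x = 0" "?g x = 0" if "x \<notin> S" for x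
  proof -
    have "rates lam V (fst x) (snd x) = 0"
      using that rates_nonneg[of "fst x" "snd x"] by (auto simp: S_def case_prod_unfold)
    then show "?f x = 0" "?g x = 0" by (simp_all add: case_prod_unfold)
  qed
  have T: "T (T x) = x" "T x \<in> S" if "x \<in> S" for x
    using that reversal by (auto simp: S_def T_def)
  have "(?f has_sum s) UNIV \<longleftrightarrow> (?f has_sum s) S"
    by (rule has_sum_cong_neutral) (use off in auto)
  also have "\<dots> \<longleftrightarrow> (?g has_sum s) S"
  proof (rule has_sum_reindex_bij_witness[where i = T and j = T])
    show "?g (T x) = ?f x" if "x \<in> S" for x
      using that reversal by (auto simp: S_def T_def mult.assoc)
  qed (use T in auto)
  also have "\<dots> \<longleftrightarrow> (?g has_sum s) UNIV"
    by (rule has_sum_cong_neutral) (use off in auto)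
  finally show ?thesis .
qed

text \<open>The birth rates are bounded, so the births are dominated by the probability itself. The
  deaths are the same series, reindexed by balance.\<close>

lemma flow_summable: "(\<lambda>(\<eta>, \<sigma>). rates lam V \<eta> \<sigma> * gibbs lam V \<eta>) summable_on UNIV"
proof -
  have up: "(\<lambda>\<eta>. birth_rate V i \<eta> * gibbs lam V \<eta>) summable_on UNIV" for i
  proof (rule summable_on_comparison_test)
    show "(\<lambda>\<eta>. birth_rate V i 0 * gibbs lam V \<eta>) summable_on UNIV"
      by (intro summable_on_cmult_right has_sum_imp_summable[OF gibbs_has_sum])
    show "birth_rate V i \<eta> * gibbs lam V \<eta> \<le> birth_rate V i 0 * gibbs lam V \<eta>" for \<eta>
      by (intro mult_right_mono birth_rate_le less_imp_le[OF gibbs_pos])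
    show "0 \<le> birth_rate V i \<eta> * gibbs lam V \<eta>" for \<eta>
      by (intro mult_nonneg_nonneg less_imp_le[OF gibbs_pos] less_imp_le[OF birth_rate_pos])
  qed
  have down: "(\<lambda>\<eta>. lam * real (\<eta> $ i) * gibbs lam V \<eta>) summable_on UNIV" for i
  proof -
    have "(\<lambda>\<eta>. birth_rate V i \<eta> * gibbs lam V \<eta>) summable_on UNIV \<longleftrightarrow>
        (\<lambda>\<eta>. lam * real (\<eta> $ i) * gibbs lam V \<eta>) summable_on {\<eta>. 0 < \<eta> $ i}"
    proof (rule summable_on_reindex_bij_witness[where j = "\<lambda>\<eta>. \<eta> + axis i 1" and i = "\<lambda>\<eta>. \<eta> - axis i 1"])
      show "lam * real ((\<eta> + axis i 1) $ i) * gibbs lam V (\<eta> + axis i 1) = birth_rate V i \<eta> * gibbs lam V \<eta>" for \<eta>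
        using gibbs_balance[of \<eta> i] by (simp add: axis_def mult_ac add.commute)
    qed (auto simp: vec_eq_iff axis_def)
    moreover have "(\<lambda>\<eta>. lam * real (\<eta> $ i) * gibbs lam V \<eta>) summable_on {\<eta>. 0 < \<eta> $ i} \<longleftrightarrow>
        (\<lambda>\<eta>. lam * real (\<eta> $ i) * gibbs lam V \<eta>) summable_on UNIV"
      by (rule summable_on_cong_neutral) auto
    ultimately show ?thesis using up by simp
  qed
  have each: "(\<lambda>\<eta>. rates lam V \<eta> \<sigma> * gibbs lam V \<eta>) summable_on UNIV" for \<sigma>
    using up down by (cases \<sigma>) auto
  have "(\<lambda>(\<eta>, \<sigma>). rates lam V \<eta> \<sigma> * gibbs lam V \<eta>) summable_on (\<Union>\<sigma>\<in>UNIV. range (\<lambda>\<eta>. (\<eta>, \<sigma>)))"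
  proof (rule summable_on_finite_union_disjoint)
    show "(\<lambda>(\<eta>, \<sigma>). rates lam V \<eta> \<sigma> * gibbs lam V \<eta>) summable_on range (\<lambda>\<eta>. (\<eta>, \<sigma>))" for \<sigma>
      using each by (subst summable_on_reindex) (auto simp: inj_def o_def)
  qed (auto simp: finite_UNIV_move)
  moreover have "(\<Union>\<sigma>\<in>UNIV. range (\<lambda>\<eta>. (\<eta>, \<sigma>))) = (UNIV :: ((nat ^ 'd) \<times> 'd move) set)" by auto
  ultimately show ?thesis by simp
qed

lemma Rev_gibbs: "Rev (rates lam V) (gibbs lam V)"
  unfolding Rev_def
proof (intro conjI allI impI)
  fix \<eta> \<sigma> assume "0 < gibbs lam V \<eta> * rates lam V \<eta> \<sigma>"
  then show "act (inv_move \<sigma>) (act \<sigma> \<eta>) = \<eta>"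
    using gibbs_pos[of \<eta>] by (intro reversal(1)) (simp add: zero_less_mult_iff)
qed (rule infsum_eqI', rule has_sum_reversal)

text \<open>Increments of \<open>f\<close> change sign under reversal while the flow is preserved,
  so their sum equals its own negative. Summing over the moves first yields the generator.\<close>

lemma invariant_gibbs: "invariant_mass (rates lam V) (gibbs lam V)"
  unfolding invariant_mass_def
proof (intro allI impI)
  fix f :: "nat ^ 'd \<Rightarrow> real" assume "bounded (range f)"
  then obtain K where K: "\<And>\<eta>. \<bar>f \<eta>\<bar> \<le> K" by (auto simp: bounded_iff)
  define F where "F = (\<lambda>\<eta> \<sigma>. f (act \<sigma> \<eta>) - f \<eta>)"
  let ?G = "\<lambda>(\<eta>, \<sigma>). F \<eta> \<sigma> * rates lam V \<eta> \<sigma> * gibbs lam V \<eta>"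
  have "?G summable_on UNIV"
  proof (rule abs_summable_summable, rule summable_on_comparison_test)
    show "(\<lambda>x. 2 * K * (case x of (\<eta>, \<sigma>) \<Rightarrow> rates lam V \<eta> \<sigma> * gibbs lam V \<eta>)) summable_on UNIV"
      by (intro summable_on_cmult_right flow_summable)
    fix x :: "(nat ^ 'd) \<times> 'd move"
    obtain \<eta> \<sigma> where x: "x = (\<eta>, \<sigma>)" by (cases x)
    have "\<bar>F \<eta> \<sigma>\<bar> \<le> 2 * K" using K[of \<eta>] K[of "act \<sigma> \<eta>"] by (simp add: F_def)
    then have "\<bar>F \<eta> \<sigma>\<bar> * (rates lam V \<eta> \<sigma> * gibbs lam V \<eta>) \<le> 2 * K * (rates lam V \<eta> \<sigma> * gibbs lam V \<eta>)"
      using rates_nonneg[of \<eta> \<sigma>] gibbs_pos[of \<eta>] by (intro mult_right_mono) auto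
    then show "norm (?G x) \<le> 2 * K * (case x of (\<eta>, \<sigma>) \<Rightarrow> rates lam V \<eta> \<sigma> * gibbs lam V \<eta>)"
      using rates_nonneg[of \<eta> \<sigma>] gibbs_pos[of \<eta>] by (simp add: x abs_mult mult.assoc)
  qed simp
  then obtain s where s: "(?G has_sum s) UNIV" by (auto simp: summable_on_def)
  then have "((\<lambda>(\<eta>, \<sigma>). F (act \<sigma> \<eta>) (inv_move \<sigma>) * rates lam V \<eta> \<sigma> * gibbs lam V \<eta>) has_sum s) UNIV"
    by (rule has_sum_reversal[THEN iffD1])
  also have "(\<lambda>(\<eta>, \<sigma>). F (act \<sigma> \<eta>) (inv_move \<sigma>) * rates lam V \<eta> \<sigma> * gibbs lam V \<eta>) = (\<lambda>x. - ?G x)"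
  proof (rule ext, clarify)
    fix \<eta> \<sigma>
    show "F (act \<sigma> \<eta>) (inv_move \<sigma>) * rates lam V \<eta> \<sigma> * gibbs lam V \<eta> = - (F \<eta> \<sigma> * rates lam V \<eta> \<sigma> * gibbs lam V \<eta>)"
      using rates_nonneg[of \<eta> \<sigma>] reversal(1)[of \<eta> \<sigma>]
      by (cases "rates lam V \<eta> \<sigma> = 0") (auto simp: F_def algebra_simps)
  qed
  finally have "((\<lambda>x. - ?G x) has_sum s) UNIV" .
  with has_sum_uminusI[OF s] have "s = - s" by (rule has_sum_unique[rotated])
  then have "(?G has_sum 0) (Sigma UNIV (\<lambda>_. UNIV))" using s by simp
  then have "((\<lambda>\<eta>. \<Sum>\<sigma>\<in>UNIV. F \<eta> \<sigma> * rates lam V \<eta> \<sigma> * gibbs lam V \<eta>) has_sum 0) UNIV"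
    by (rule has_sum_SigmaD) (simp add: finite_UNIV_move)
  moreover have "(\<Sum>\<sigma>\<in>UNIV. F \<eta> \<sigma> * rates lam V \<eta> \<sigma> * gibbs lam V \<eta>) = generator (rates lam V) f \<eta> * gibbs lam V \<eta>" for \<eta>
    unfolding generator_def sum_move sum_distrib_right
    by (rule sum.cong) (simp_all add: nabla_def F_def algebra_simps del: act.simps rates.simps)
  ultimately show "((\<lambda>\<eta>. generator (rates lam V) f \<eta> * gibbs lam V \<eta>) has_sum 0) UNIV" by simp
qed

text \<open>Any two configurations communicate through the origin.\<close>

lemma irreducible_gibbs: "irreducible_rates (rates lam V)"
proof -
  define R where "R = {(\<eta>, act \<sigma> \<eta>) |\<eta> \<sigma>. rates lam V \<eta> \<sigma> > 0}"
  have up_edge: "(\<eta>, \<eta> + axis i 1) \<in> R" for \<eta> i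
    unfolding R_def using birth_rate_pos[of i \<eta>] by (intro CollectI exI[of _ \<eta>] exI[of _ "Up i"]) simp
  have down_edge: "(\<eta> + axis i 1, \<eta>) \<in> R" for \<eta> i
    unfolding R_def using lam_pos
    by (intro CollectI exI[of _ "\<eta> + axis i 1"] exI[of _ "Down i"]) (simp add: axis_def vec_eq_iff)
  have "(0, \<eta>) \<in> R\<^sup>*" for \<eta>
  proof (induction \<eta> rule: nat_vec_induct)
    case (up \<eta> i)
    then show ?case using up_edge by (rule rtrancl_into_rtrancl)
  qed simp
  moreover have "(\<eta>, 0) \<in> R\<^sup>*" for \<eta>
  proof (induction \<eta> rule: nat_vec_induct)
    case (up \<eta> i)
    show ?case by (rule converse_rtrancl_into_rtrancl[OF down_edge up])
  qed simp
  ultimately have "(\<eta>, \<xi>) \<in> R\<^sup>*" for \<eta> \<xi> by (rule rtrancl_trans[rotated])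
  then show ?thesis by (auto simp: irreducible_rates_def R_def)
qed

lemma Irr_gibbs: "Irr (rates lam V) (gibbs lam V)"
  unfolding Irr_def prob_mass_def
  using irreducible_gibbs invariant_gibbs gibbs_has_sum flow_summable less_imp_le[OF gibbs_pos] by blast

section \<open>Truncation to boxes and passage to the limit\<close>

lemma birth_death_box_truncation:
  assumes gap: "\<And>\<eta> i. (\<Sum>j\<in>UNIV - {i}. birth_rate V j \<eta> - birth_rate V j (\<eta> + axis i 1)) \<le> lam"
    and curv: "\<And>\<eta> i. k \<le> lam + (birth_rate V i \<eta> - birth_rate V i (\<eta> + axis i 1))
      - (\<Sum>j\<in>UNIV - {i}. birth_rate V j \<eta> - birth_rate V j (\<eta> + axis i 1))"
  shows "birth_death_box (box N) (\<lambda>\<eta>. if \<eta> \<in> box N then gibbs lam V \<eta> else 0)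
    (\<lambda>i \<eta>. if \<eta> $ i < N then birth_rate V i \<eta> else 0) lam k"
proof
  have up_le: "\<eta> $ j \<le> (\<eta> + axis i 1) $ j" for \<eta> :: "nat ^ 'd" and i j by (simp add: axis_def)
  have up_diff: "(\<eta> + axis i 1) $ j = \<eta> $ j" if "j \<noteq> i" for \<eta> :: "nat ^ 'd" and i j
    using that by (simp add: axis_def)
  let ?B = "\<lambda>i \<eta>. if \<eta> $ i < N then birth_rate V i \<eta> else 0"
  \<comment> \<open>For \<open>j \<noteq> i\<close> the two configurations have the same
    \<open>j\<close>-th coordinate, so the birth in direction \<open>j\<close> is killed at both or
    at neither; killing replaces a nonnegative difference by 0.\<close>
  have gap_mono: "(\<Sum>j\<in>UNIV - {i}. ?B j \<eta> - ?B j (\<eta> + axis i 1))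
      \<le> (\<Sum>j\<in>UNIV - {i}. birth_rate V j \<eta> - birth_rate V j (\<eta> + axis i 1))" for \<eta> i
    using birth_antimono by (intro sum_mono) (auto simp: up_diff simp del: One_nat_def vector_add_component)
  fix \<eta> :: "nat ^ 'd" and i j
  show "finite (box N :: (nat ^ 'd) set)" by (rule finite_box)
  show "0 \<in> (box N :: (nat ^ 'd) set)" by (simp add: box_def)
  show "0 < lam" by (rule lam_pos)
  show "0 < (if \<eta> \<in> box N then gibbs lam V \<eta> else 0)" if "\<eta> \<in> box N" using that gibbs_pos by simp
  show "(if \<eta> \<in> box N then gibbs lam V \<eta> else 0) = 0" if "\<eta> \<notin> box N" using that by simp
  show "0 \<le> ?B i \<eta>" using birth_rate_pos[of i \<eta>] by simp
  show "(if \<eta> \<in> box N then gibbs lam V \<eta> else 0) * ?B i \<eta>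
      = (if \<eta> + axis i 1 \<in> box N then gibbs lam V (\<eta> + axis i 1) else 0) * (lam * (real (\<eta> $ i) + 1))"
    if "\<eta> \<in> box N"
  proof -
    have "\<eta> + axis i 1 \<in> box N \<longleftrightarrow> \<eta> $ i < N"
      using that by (auto simp: box_def axis_def dest: spec[of _ i])
    then show ?thesis using that gibbs_balance[of \<eta> i] by simp
  qed
  assume X: "\<eta> + axis i 1 \<in> box N"
  then have i: "\<eta> $ i < N" by (auto simp: box_def axis_def dest: spec[of _ i])
  show "\<eta> \<in> box N" using X up_le order_trans unfolding box_def by blast
  show "?B j (\<eta> + axis i 1) \<le> ?B j \<eta>"
    using birth_antimono[of j \<eta> i] birth_rate_pos[of j \<eta>] up_le[of \<eta> j i] by auto
  show "(\<Sum>j\<in>UNIV - {i}. ?B j \<eta> - ?B j (\<eta> + axis i 1)) \<le> lam"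
    using gap_mono[where i = i and \<eta> = \<eta>] gap[where i = i and \<eta> = \<eta>] by linarith
  show "k \<le> lam + (?B i \<eta> - ?B i (\<eta> + axis i 1)) - (\<Sum>j\<in>UNIV - {i}. ?B j \<eta> - ?B j (\<eta> + axis i 1))"
  proof -
    \<comment> \<open>In direction \<open>i\<close> the birth at the lower endpoint is alive, and
      killing the one at the upper endpoint can only enlarge the surplus.\<close>
    have "?B i (\<eta> + axis i 1) \<le> birth_rate V i (\<eta> + axis i 1)"
      using birth_rate_pos[of i "\<eta> + axis i 1"] by simp
    moreover have "?B i \<eta> = birth_rate V i \<eta>" using i by simp
    ultimately show ?thesis using gap_mono[where i = i and \<eta> = \<eta>] curv[where i = i and \<eta> = \<eta>] by linarith
  qed
qed

text \<open>Every box edge occurs twice in the full sum, as a birth and as the reverse death, with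
  equal terms by balance and symmetry of \<open>Phi\<close>. These terms form a finite part of a
  nonnegative series.\<close>

lemma box_energy_le:
  assumes Phi_nonneg: "\<And>a b. 0 < a \<Longrightarrow> 0 < b \<Longrightarrow> 0 \<le> Phi \<phi> a b" and f: "\<And>\<eta>. 0 < f \<eta>"
  shows "ereal (2 * (\<Sum>\<eta>\<in>box N. \<Sum>i\<in>UNIV.
        gibbs lam V \<eta> * (if \<eta> $ i < N then birth_rate V i \<eta> else 0) * Phi \<phi> (f \<eta>) (f (\<eta> + axis i 1))))
     \<le> (\<Sum>\<^sub>\<infinity>(\<eta>, \<sigma>)\<in>UNIV. ereal (rates lam V \<eta> \<sigma> * Phi \<phi> (f \<eta>) (f (act \<sigma> \<eta>)) * gibbs lam V \<eta>))"
proof -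
  define G where "G = (\<lambda>(\<eta>, \<sigma>). rates lam V \<eta> \<sigma> * Phi \<phi> (f \<eta>) (f (act \<sigma> \<eta>)) * gibbs lam V \<eta>)"
  have G: "0 \<le> G x" for x
    using rates_nonneg Phi_nonneg f less_imp_le[OF gibbs_pos]
    by (auto simp: G_def intro!: mult_nonneg_nonneg split: prod.split)
  define A where "A = {(\<eta>, i :: 'd). \<eta> \<in> (box N :: (nat ^ 'd) set) \<and> \<eta> $ i < N}"
  have A: "finite A" by (rule finite_subset[of _ "box N \<times> UNIV"]) (auto simp: A_def finite_box)
  define up where "up = (\<lambda>(\<eta>, i). (\<eta>, Up i) :: (nat ^ 'd) \<times> 'd move)"
  define down where "down = (\<lambda>(\<eta>, i). (\<eta> + axis i 1, Down i) :: (nat ^ 'd) \<times> 'd move)"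
  have inj: "inj_on up A" "inj_on down A" by (auto simp: inj_on_def up_def down_def)
  have disj: "up ` A \<inter> down ` A = {}" by (auto simp: up_def down_def)
  have G_eq: "G (down x) = G (up x)" for x
  proof (cases x)
    case (Pair \<eta> i)
    have "\<eta> + axis i 1 - axis i 1 = \<eta>" by (simp add: vec_eq_iff)
    moreover have "real ((\<eta> + axis i 1) $ i) = real (\<eta> $ i) + 1" by (simp add: axis_def)
    moreover have "0 < (\<eta> + axis i 1) $ i" by (simp add: axis_def)
    moreover have "Phi \<phi> a b = Phi \<phi> b a" for a b by (simp add: Phi_def algebra_simps)
    ultimately show ?thesis
      using gibbs_balance[of \<eta> i]
      by (simp add: Pair G_def up_def down_def mult_ac del: One_nat_def vector_add_component)
  qed
  have "(\<Sum>\<eta>\<in>box N. \<Sum>i\<in>UNIV.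
        gibbs lam V \<eta> * (if \<eta> $ i < N then birth_rate V i \<eta> else 0) * Phi \<phi> (f \<eta>) (f (\<eta> + axis i 1)))
      = (\<Sum>(\<eta>, i)\<in>box N \<times> UNIV.
        gibbs lam V \<eta> * (if \<eta> $ i < N then birth_rate V i \<eta> else 0) * Phi \<phi> (f \<eta>) (f (\<eta> + axis i 1)))"
    by (rule sum.cartesian_product)
  also have "\<dots> = (\<Sum>x\<in>A. G (up x))"
    by (rule sum.mono_neutral_cong_right) (auto simp: A_def G_def up_def finite_box mult_ac split: if_splits)
  finally have "2 * (\<Sum>\<eta>\<in>box N. \<Sum>i\<in>UNIV.
        gibbs lam V \<eta> * (if \<eta> $ i < N then birth_rate V i \<eta> else 0) * Phi \<phi> (f \<eta>) (f (\<eta> + axis i 1)))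
      = (\<Sum>x\<in>A. G (up x)) + (\<Sum>x\<in>A. G (down x))" by (simp add: G_eq)
  also have "\<dots> = sum G (up ` A \<union> down ` A)"
    using A disj inj by (simp add: sum.union_disjoint sum.reindex)
  finally have "ereal (2 * (\<Sum>\<eta>\<in>box N. \<Sum>i\<in>UNIV.
        gibbs lam V \<eta> * (if \<eta> $ i < N then birth_rate V i \<eta> else 0) * Phi \<phi> (f \<eta>) (f (\<eta> + axis i 1))))
      = (\<Sum>x\<in>up ` A \<union> down ` A. ereal (G x))" by simp
  also have "\<dots> \<le> (\<Sum>\<^sub>\<infinity>x. ereal (G x))"
    using A G by (subst nonneg_infsum_complete) (auto intro!: SUP_upper)
  also have "(\<lambda>x. ereal (G x)) = (\<lambda>(\<eta>, \<sigma>). ereal (rates lam V \<eta> \<sigma> * Phi \<phi> (f \<eta>) (f (act \<sigma> \<eta>)) * gibbs lam V \<eta>))"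
    by (auto simp: G_def)
  finally show ?thesis .
qed

text \<open>The limit of \<open>box_sobolev\<close> along growing boxes. When \<open>k\<close> is
  positive and the right-hand side is finite, finiteness of the entropy is itself obtained from the
  box inequalities.\<close>

lemma convex_sobolev_gibbs:
  assumes \<phi>: "sobolev_cost \<alpha> \<phi>" and "0 \<le> k"
    and gap: "\<And>\<eta> i. (\<Sum>j\<in>UNIV - {i}. birth_rate V j \<eta> - birth_rate V j (\<eta> + axis i 1)) \<le> lam"
    and curv: "\<And>\<eta> i. k \<le> lam + (birth_rate V i \<eta> - birth_rate V i (\<eta> + axis i 1))
      - (\<Sum>j\<in>UNIV - {i}. birth_rate V j \<eta> - birth_rate V j (\<eta> + axis i 1))"
  shows "convex_sobolev (rates lam V) (gibbs lam V) \<phi> (ereal (\<alpha> * k))"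
  unfolding convex_sobolev_def
proof (intro allI impI, elim conjE)
  fix f :: "nat ^ 'd \<Rightarrow> real"
  assume "\<forall>\<eta>. 0 < f \<eta>" and f_sum: "(\<lambda>\<eta>. f \<eta> * gibbs lam V \<eta>) summable_on UNIV"
  then have f: "0 < f \<eta>" for \<eta> by simp
  define D where "D = (\<Sum>\<^sub>\<infinity>(\<eta>, \<sigma>)\<in>UNIV. ereal (rates lam V \<eta> \<sigma> * Phi \<phi> (f \<eta>) (f (act \<sigma> \<eta>)) * gibbs lam V \<eta>))"
  have P: "coupling_cost \<alpha> (Phi \<phi>)" and cont: "\<And>a. 0 < a \<Longrightarrow> isCont \<phi> a"
    and \<phi>_nonneg: "\<And>a. 0 < a \<Longrightarrow> 0 \<le> \<phi> a"
    and tangent: "\<And>a x. 0 < a \<Longrightarrow> 0 < x \<Longrightarrow> \<phi> a + deriv \<phi> a * (x - a) \<le> \<phi> x"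
    using \<phi> by (auto simp: sobolev_cost_def)
  have \<alpha>: "1 \<le> \<alpha>" using P by (simp add: coupling_cost_def)
  define e where "e = (\<lambda>N. \<Sum>\<eta>\<in>box N. \<Sum>i\<in>UNIV.
        gibbs lam V \<eta> * (if \<eta> $ i < N then birth_rate V i \<eta> else 0) * Phi \<phi> (f \<eta>) (f (\<eta> + axis i 1)))"
  have e_le: "ereal (2 * e N) \<le> D" for N
    unfolding e_def D_def by (intro box_energy_le coupling_cost_nonneg[OF P] f)
  have "0 \<le> D" using e_le[of 0] by (simp add: e_def zero_ereal_def)
  show "ereal (\<alpha> * k) * phi_entropy \<phi> f (gibbs lam V) \<le> 1 / 2 *
      (\<Sum>\<^sub>\<infinity>(\<eta>, \<sigma>)\<in>UNIV. ereal (rates lam V \<eta> \<sigma> * Phi \<phi> (f \<eta>) (f (act \<sigma> \<eta>)) * gibbs lam V \<eta>))"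
    unfolding D_def[symmetric]
  \<comment> \<open>For \<open>k = 0\<close> the left-hand side is 0 even if the entropy is
    infinite; for \<open>D = \<infinity>\<close> the right-hand side is infinite. Otherwise
    everything can be computed in the reals.\<close>
  proof (cases "k = 0 \<or> D = \<infinity>")
    case True
    then show "ereal (\<alpha> * k) * phi_entropy \<phi> f (gibbs lam V) \<le> 1 / 2 * D"
      using \<open>0 \<le> D\<close> by (auto simp: zero_ereal_def[symmetric])
  next
    case False
    then have "0 < k" "D \<noteq> \<infinity>" using \<open>0 \<le> k\<close> by auto
    then obtain d where d: "D = ereal d" using \<open>0 \<le> D\<close> by (cases D) auto
    have e_le_d: "e N \<le> d / 2" for N using e_le[of N] by (simp add: d)
    have \<alpha>k: "0 < \<alpha> * k" using \<alpha> \<open>0 < k\<close> by simp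
    define E where "E = (\<lambda>N. \<Sum>\<eta>\<in>box N. \<phi> (f \<eta>) * gibbs lam V \<eta>)"
    define U where "U = (\<lambda>N. \<Sum>\<eta>\<in>(box N :: (nat ^ 'd) set). gibbs lam V \<eta>)"
    define M where "M = (\<lambda>N. \<Sum>\<eta>\<in>box N. f \<eta> * gibbs lam V \<eta>)"
    define mean where "mean = (\<Sum>\<^sub>\<infinity>\<eta>. f \<eta> * gibbs lam V \<eta>)"
    have finite_ineq: "\<alpha> * k * (E N - U N * \<phi> (M N / U N)) \<le> d / 2" for N
    proof -
      interpret T: birth_death_box "box N" "\<lambda>\<eta>. if \<eta> \<in> box N then gibbs lam V \<eta> else 0"
        "\<lambda>i \<eta>. if \<eta> $ i < N then birth_rate V i \<eta> else 0" lam k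
        by (rule birth_death_box_truncation[OF gap curv])
      have "T.energy (\<lambda>a b. (deriv \<phi> b - deriv \<phi> a) * (b - a)) f = e N"
        unfolding T.energy_def e_def by (simp add: Phi_def)
      moreover have "coupling_cost \<alpha> (\<lambda>a b. (deriv \<phi> b - deriv \<phi> a) * (b - a))"
        using P by (simp add: Phi_def[abs_def])
      ultimately have "\<alpha> * k * (E N - U N * \<phi> (M N / U N)) \<le> e N"
        using T.box_sobolev[of \<alpha> "deriv \<phi>" \<phi> f] tangent cont f \<open>0 < k\<close>
        by (simp add: E_def U_def M_def mult.commute[of "gibbs lam V _"])
      then show ?thesis using e_le_d[of N] by linarith
    qed
    have lim: "(\<lambda>N. sum g (box N)) \<longlonglongrightarrow> s" if "(g has_sum s) UNIV" for g :: "nat ^ 'd \<Rightarrow> real" and s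
      using filterlim_compose[OF _ filterlim_box] that by (auto simp: has_sum_def)
    have U: "U \<longlonglongrightarrow> 1" unfolding U_def by (intro lim gibbs_has_sum)
    have M: "M \<longlonglongrightarrow> mean" unfolding M_def mean_def by (intro lim has_sum_infsum f_sum)
    \<comment> \<open>Positivity puts the mean where \<phi> is known to be continuous.\<close>
    have "0 < f 0 * gibbs lam V 0" using f gibbs_pos by simp
    also have "\<dots> \<le> mean"
      unfolding mean_def using finite_sum_le_infsum[OF f_sum, of "{0}"] f less_imp_le[OF gibbs_pos] less_imp_le[OF f]
      by simp
    finally have mean_pos: "0 < mean" .
    have "(\<lambda>N. M N / U N) \<longlonglongrightarrow> mean / 1" using M U by (intro tendsto_divide) auto
    then have "(\<lambda>N. \<phi> (M N / U N)) \<longlonglongrightarrow> \<phi> mean"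
      using cont[OF mean_pos] by (auto intro: isCont_tendsto_compose)
    then have lim_rhs: "(\<lambda>N. d / (2 * (\<alpha> * k)) + U N * \<phi> (M N / U N)) \<longlonglongrightarrow> d / (2 * (\<alpha> * k)) + 1 * \<phi> mean"
      by (intro tendsto_intros U)
    have E_le: "E N \<le> d / (2 * (\<alpha> * k)) + U N * \<phi> (M N / U N)" for N
    proof -
      have "E N - U N * \<phi> (M N / U N) \<le> d / 2 / (\<alpha> * k)"
        unfolding pos_le_divide_eq[OF \<alpha>k] using finite_ineq[of N] by (simp add: mult.commute)
      then show ?thesis by simp
    qed
    \<comment> \<open>The convergent upper bounds are bounded by \<open>K\<close>, hence so are the
      box entropies; as their terms are nonnegative, the entropy series converges.\<close>
    obtain K where K: "\<And>N. d / (2 * (\<alpha> * k)) + U N * \<phi> (M N / U N) \<le> K"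
      using convergent_imp_Bseq[OF convergentI[OF lim_rhs]] unfolding Bseq_def
      by (metis abs_le_D1 real_norm_def)
    have term_nonneg: "0 \<le> \<phi> (f \<eta>) * gibbs lam V \<eta>" for \<eta>
      using \<phi>_nonneg[OF f] gibbs_pos[of \<eta>] by simp
    have E_sum: "(\<lambda>\<eta>. \<phi> (f \<eta>) * gibbs lam V \<eta>) summable_on UNIV"
    proof (rule nonneg_bdd_above_summable_on[OF term_nonneg])
      have "(\<Sum>\<eta>\<in>F. \<phi> (f \<eta>) * gibbs lam V \<eta>) \<le> K" if F: "finite F" for F
      proof -
        obtain N where "F \<subseteq> box N" using finite_subset_box[OF F] by (metis order_refl)
        then have "(\<Sum>\<eta>\<in>F. \<phi> (f \<eta>) * gibbs lam V \<eta>) \<le> E N"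
          unfolding E_def by (intro sum_mono2 finite_box term_nonneg)
        then show ?thesis using E_le[of N] K[of N] by linarith
      qed
      then show "bdd_above (sum (\<lambda>\<eta>. \<phi> (f \<eta>) * gibbs lam V \<eta>) ` {F. F \<subseteq> UNIV \<and> finite F})"
        by (auto intro!: bdd_aboveI)
    qed
    define entropy_sum where "entropy_sum = (\<Sum>\<^sub>\<infinity>\<eta>. \<phi> (f \<eta>) * gibbs lam V \<eta>)"
    have "E \<longlonglongrightarrow> entropy_sum" unfolding E_def entropy_sum_def by (intro lim has_sum_infsum E_sum)
    from LIMSEQ_le[OF this lim_rhs] have "entropy_sum \<le> d / (2 * (\<alpha> * k)) + \<phi> mean" using E_le by auto
    then have "entropy_sum - \<phi> mean \<le> d / 2 / (\<alpha> * k)" by simp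
    then have "\<alpha> * k * (entropy_sum - \<phi> mean) \<le> d / 2"
      unfolding pos_le_divide_eq[OF \<alpha>k] by (simp add: mult.commute)
    moreover have "phi_entropy \<phi> f (gibbs lam V) = ereal (entropy_sum - \<phi> mean)"
      unfolding phi_entropy_def using infsum_ereal_nonneg[OF E_sum term_nonneg]
      by (simp add: entropy_sum_def mean_def)
    moreover have "1 / 2 * D = ereal (d / 2)"
      by (simp add: d one_ereal_def numeral_eq_ereal)
    ultimately show "ereal (\<alpha> * k) * phi_entropy \<phi> f (gibbs lam V) \<le> 1 / 2 * D" by simp
  qed
qed

end

theorem corollary3p2:
  fixes lam :: real and V :: "real ^ 'd::finite \<Rightarrow> real"
  assumes "lam > 0"
    and "twice_cont_diff V"
    and "\<forall>x i j. partial i (partial j V) x \<ge> 0"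
    and "(INF (\<eta>, i)\<in>UNIV. ereal
           (lam - (\<Sum>j\<in>UNIV - {i}. birth_rate V j \<eta> - birth_rate V j (act (Up i) \<eta>)))) \<ge> 0"
  shows
    "(Irr (rates lam V) (gibbs lam V) \<and> Rev (rates lam V) (gibbs lam V) \<and>
      (\<forall>\<phi>. admissible \<phi> \<longrightarrow> convex_sobolev (rates lam V) (gibbs lam V) \<phi> (kappa lam V)) \<and>
      modified_log_sobolev (rates lam V) (gibbs lam V) (kappa lam V) \<and>
      (\<forall>\<alpha>::real. 1 < \<alpha> \<and> \<alpha> \<le> 2 \<longrightarrow>
        beckner (rates lam V) (gibbs lam V) \<alpha> (ereal \<alpha> * kappa lam V)))
     \<and>
     (kappa0 lam V \<ge> 0 \<longrightarrow>
      Irr (rates lam V) (gibbs lam V) \<and> Rev (rates lam V) (gibbs lam V) \<and>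
      (\<forall>\<phi>. admissible \<phi> \<longrightarrow>
        convex_sobolev (rates lam V) (gibbs lam V) \<phi> (ereal (kappa0 lam V))) \<and>
      modified_log_sobolev (rates lam V) (gibbs lam V) (ereal (kappa0 lam V)) \<and>
      (\<forall>\<alpha>::real. 1 < \<alpha> \<and> \<alpha> \<le> 2 \<longrightarrow>
        beckner (rates lam V) (gibbs lam V) \<alpha> (ereal (\<alpha> * kappa0 lam V))))"
proof -
  interpret lattice_gibbs lam V
    using assms(1-3) by unfold_locales (auto intro: birth_rate_antimono simp del: One_nat_def)
  define \<Delta> where "\<Delta> = (\<lambda>\<eta> i. \<Sum>j\<in>UNIV - {i}. birth_rate V j \<eta> - birth_rate V j (\<eta> + axis i 1))"
  have gap: "\<Delta> \<eta> i \<le> lam" for \<eta> i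
  proof -
    have "0 \<le> ereal (lam - \<Delta> \<eta> i)"
      using assms(4) unfolding le_INF_iff \<Delta>_def by (auto simp del: One_nat_def)
    then show ?thesis by simp
  qed
  have results: "(\<forall>\<phi>. admissible \<phi> \<longrightarrow> convex_sobolev (rates lam V) (gibbs lam V) \<phi> (ereal k)) \<and>
      modified_log_sobolev (rates lam V) (gibbs lam V) (ereal k) \<and>
      (\<forall>\<alpha>::real. 1 < \<alpha> \<and> \<alpha> \<le> 2 \<longrightarrow> beckner (rates lam V) (gibbs lam V) \<alpha> (ereal (\<alpha> * k)))"
    if k: "0 \<le> k" "\<And>\<eta> i. k \<le> lam + (birth_rate V i \<eta> - birth_rate V i (\<eta> + axis i 1)) - \<Delta> \<eta> i" for k
  proof -
    have main: "convex_sobolev (rates lam V) (gibbs lam V) \<phi> (ereal (\<alpha> * k))" if "sobolev_cost \<alpha> \<phi>" for \<alpha> \<phi>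
      using convex_sobolev_gibbs[OF that k(1)] gap k(2) by (simp add: \<Delta>_def del: One_nat_def)
    show ?thesis
      using main[OF admissible_imp_sobolev_cost] main[OF sobolev_cost_phi_log] main[OF sobolev_cost_phi_beckner]
      by (simp add: modified_log_sobolev_def beckner_def)
  qed
  define c where "c = (\<lambda>\<eta> i. lam + (birth_rate V i \<eta> - birth_rate V i (\<eta> + axis i 1)) - \<Delta> \<eta> i)"
  \<comment> \<open>The surplus in the particle's own direction is nonnegative, so the assumed
    infimum bound already makes \<open>kappa\<close> nonnegative.\<close>
  have c_nonneg: "0 \<le> c \<eta> i" for \<eta> i
    using gap[of \<eta> i] birth_antimono[of i \<eta> i] by (simp add: c_def del: One_nat_def)
  have kappa: "kappa lam V = (INF (\<eta>, i)\<in>UNIV. ereal (c \<eta> i))"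
    by (simp add: kappa_def c_def \<Delta>_def del: One_nat_def)
  have kappa_le: "kappa lam V \<le> ereal (c \<eta> i)" for \<eta> i
    unfolding kappa by (rule INF_lower2[of "(\<eta>, i)"]) auto
  have "0 \<le> kappa lam V"
    unfolding kappa using c_nonneg by (auto intro!: INF_greatest)
  \<comment> \<open>A single pair bounds the infimum from above, so it is a real number;
    \<open>undefined\<close> stands for an arbitrary coordinate.\<close>
  then obtain k where k: "kappa lam V = ereal k" "0 \<le> k"
    using kappa_le[of 0 undefined] by (cases "kappa lam V") auto
  have "k \<le> c \<eta> i" for \<eta> i using kappa_le[of \<eta> i] by (simp add: k)
  from results[OF k(2) this[unfolded c_def]] have part1: "(\<forall>\<phi>. admissible \<phi> \<longrightarrow> convex_sobolev (rates lam V) (gibbs lam V) \<phi> (kappa lam V)) \<and>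
      modified_log_sobolev (rates lam V) (gibbs lam V) (kappa lam V) \<and>
      (\<forall>\<alpha>::real. 1 < \<alpha> \<and> \<alpha> \<le> 2 \<longrightarrow>
        beckner (rates lam V) (gibbs lam V) \<alpha> (ereal \<alpha> * kappa lam V))"
    by (simp add: k)
  \<comment> \<open>Dropping the subtracted rates and moving the others to the origin, where they
    are largest, bounds \<open>\<Delta> \<eta> i\<close>; the surplus in direction \<open>i\<close>
    is nonnegative and only helps.\<close>
  have "kappa0 lam V \<le> c \<eta> i" for \<eta> i
  proof -
    have "\<Delta> \<eta> i \<le> (\<Sum>j\<in>UNIV - {i}. birth_rate V j 0)"
      unfolding \<Delta>_def
    proof (rule sum_mono)
      show "birth_rate V j \<eta> - birth_rate V j (\<eta> + axis i 1) \<le> birth_rate V j 0" for j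
        using birth_rate_le[of j \<eta>] birth_rate_pos[of j "\<eta> + axis i 1"] by linarith
    qed
    moreover have "kappa0 lam V \<le> lam - (\<Sum>j\<in>UNIV - {i}. birth_rate V j 0)"
      unfolding kappa0_def by (rule Min_le) auto
    ultimately show ?thesis using birth_antimono[of i \<eta> i] by (simp add: c_def del: One_nat_def)
  qed
  then have part2: "0 \<le> kappa0 lam V \<Longrightarrow> (\<forall>\<phi>. admissible \<phi> \<longrightarrow>
        convex_sobolev (rates lam V) (gibbs lam V) \<phi> (ereal (kappa0 lam V))) \<and>
      modified_log_sobolev (rates lam V) (gibbs lam V) (ereal (kappa0 lam V)) \<and>
      (\<forall>\<alpha>::real. 1 < \<alpha> \<and> \<alpha> \<le> 2 \<longrightarrow>
        beckner (rates lam V) (gibbs lam V) \<alpha> (ereal (\<alpha> * kappa0 lam V)))"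
    using results[of "kappa0 lam V"] unfolding c_def by blast
  show ?thesis using Irr_gibbs Rev_gibbs part1 part2 by blast
qed

end
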